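(* Let $\alpha>0$, $\gamma>0$ and let $\kappa$ be a fragmentation kernel. Let $\mu^F_t$ be the unique fundamental solution of the fragmentation equation, i.e. the unique (non-negative) solution with initial datum $\mu_0=\delta(x-1)$, and define, for $t>0$, $$\kappa^{est}(t)=\frac{\mu^F_t-e^{-\alpha t}\delta(x-1)}{\alpha t}.$$ Then, for every $T>0$, $$\big\|\kappa^{est}(t)-\kappa\big\|_{TV}\le C\,t\qquad\forall t\in(0,T],$$ with $$C=\alpha\max_{t\in[0,T]}\sum_{n=0}^\infty(\alpha t)^n\|a_{n+2}\|_{TV}=\alpha\sum_{n=0}^\infty(\alpha T)^n\|a_{n+2}\|_{TV},$$ where the measures $a_n$ are defined by $$a_0=0,\qquad a_{n+1}=\frac1{n+1}\Big(-x^\gamma a_n+\kappa\ast(y^\gamma a_n)+\frac{(-1)^n}{n!}\kappa\Big).$$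
   Context: $\mathbb R^+=[0,\infty)$. $\mathcal M(\mathbb R^+)$ is the space of signed Radon measures supported in $\mathbb R^+$, endowed with the total variation norm $\|\mu\|_{TV}=\sup\{\int\varphi\,d\mu:\ \varphi\in\mathcal C(\mathbb R^+)\cap L^1(d|\mu|),\ \|\varphi\|_\infty\le1\}$, for which it is a Banach space (so its elements are finite measures); $\mathcal M^+(\mathbb R^+)$ is the subset of non-negative measures. Fragmentation kernel: $\kappa\in\mathcal M^+(\mathbb R^+)$ with no atom at $0$ nor at $1$, $\operatorname{supp}(\kappa)\subset[0,1]$, $\int_0^1 d\kappa(z)=N<+\infty$, $\int_0^1 z\,d\kappa(z)=1$. Fragmentation equation (formally): $\partial_t\mu_t(x)=-\alpha x^\gamma\mu_t(x)+\alpha\int_x^\infty\kappa(x/y)\,y^{\gamma-1}d\mu_t(y)$, $\mu_{t=0}=\mu_0$. A measure-valued solution is a family $(\mu_t)_{t\ge0}\subset\mathcal M(\mathbb R^+)$ such that $t\mapsto\mu_t$ is narrowly continuous and, for all $\varphi\in\mathcal C(\mathbb R^+)$ such that $x\mapsto\varphi(x)/(1+x)$ is bounded on $[0,\infty)$ and all $t\ge0$, $$\int_{\mathbb R^+}\varphi\,d\mu_t=\int_{\mathbb R^+}\varphi\,d\mu_0+\int_0^t ds\int_{\mathbb R^+}d\mu_s(x)\,\alpha x^\gamma\Big(-\varphi(x)+\int_0^1 d\kappa(z)\varphi(xz)\Big).$$ For compactly supported $\mu_0\in\mathcal M^+(\mathbb R^+)$ there is a unique non-negative such solution in $\mathcal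 C(\mathbb R^+,(\mathcal M(\mathbb R^+),\|\cdot\|_{TV}))$; it is the solution meant in the claim. Mellin (multiplicative) convolution of two compactly supported finite measures on $\mathbb R^+$: $\int\varphi\,d(\mu\ast\nu)=\iint\varphi(xy)\,d\mu(x)\,d\nu(y)$ for all $\varphi\in\mathcal C(\mathbb R^+)$. Here $x^\gamma a_n$ (or $y^\gamma a_n$) denotes $a_n$ multiplied by the function $x\mapsto x^\gamma$. *)

theory Defs
  imports "HOL-Analysis.Analysis"
begin

section \<open>Finite signed measures on the half line\<close>

text \<open>
  Every finite signed Borel measure on the half line is Radon, so the signed Radon measures of
  finite total variation are exactly the real-valued countably additive functions on the Borel
  subsets of \<open>{0..}\<close>. As for the library's \<^const>\<open>measure\<close>, the value on
  non-measurable sets is \<open>0\<close>, which makes equality of such functions equality of measures.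
\<close>

abbreviation borel_Rp :: "real measure"
  where "borel_Rp \<equiv> restrict_space borel {0..}"

typedef smeasure =
  "{\<mu> :: real set \<Rightarrow> real.
     (\<forall>A. A \<notin> sets borel_Rp \<longrightarrow> \<mu> A = 0) \<and>
     (\<forall>A :: nat \<Rightarrow> real set. range A \<subseteq> sets borel_Rp \<longrightarrow> disjoint_family A \<longrightarrow>
        (\<lambda>i. \<mu> (A i)) sums \<mu> (\<Union>i. A i))}"
  morphisms meas Abs_smeasure
  by (rule exI[of _ "\<lambda>_. 0"]) auto

setup_lifting type_definition_smeasure

lemma smeasure_eqI:
  assumes "\<And>A. A \<in> sets borel_Rp \<Longrightarrow> meas \<mu> A = meas \<nu> A"
  shows "\<mu> = \<nu>"
proof -
  have "meas \<mu> A = meas \<nu> A" for A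
    using assms[of A] by (cases "A \<in> sets borel_Rp") (transfer; auto)+
  then show ?thesis by (simp add: meas_inject[symmetric] fun_eq_iff)
qed

instantiation smeasure :: real_vector
begin

lift_definition zero_smeasure :: smeasure is "\<lambda>_. 0" by auto

lift_definition plus_smeasure :: "smeasure \<Rightarrow> smeasure \<Rightarrow> smeasure"
  is "\<lambda>\<mu> \<nu> A. \<mu> A + \<nu> A" by (auto intro!: sums_add)

lift_definition minus_smeasure :: "smeasure \<Rightarrow> smeasure \<Rightarrow> smeasure"
  is "\<lambda>\<mu> \<nu> A. \<mu> A - \<nu> A" by (auto intro!: sums_diff)

lift_definition uminus_smeasure :: "smeasure \<Rightarrow> smeasure"
  is "\<lambda>\<mu> A. - \<mu> A" by (auto intro!: sums_minus)

lift_definition scaleR_smeasure :: "real \<Rightarrow> smeasure \<Rightarrow> smeasure"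
  is "\<lambda>c \<mu> A. c * \<mu> A" by (auto intro!: sums_mult)

instance
  by standard (transfer; auto simp: algebra_simps)+

end

lemma meas_simps [simp]:
  "meas 0 A = 0"
  "meas (\<mu> + \<nu>) A = meas \<mu> A + meas \<nu> A"
  "meas (\<mu> - \<nu>) A = meas \<mu> A - meas \<nu> A"
  "meas (- \<mu>) A = - meas \<mu> A"
  "meas (c *\<^sub>R \<mu>) A = c * meas \<mu> A"
  by (transfer; simp)+

lemma meas_sums:
  assumes "range A \<subseteq> sets borel_Rp" "disjoint_family (A :: nat \<Rightarrow> real set)"
  shows "(\<lambda>i. meas \<mu> (A i)) sums meas \<mu> (\<Union>i. A i)"
  using assms by transfer auto

lemma meas_notin [simp]: "A \<notin> sets borel_Rp \<Longrightarrow> meas \<mu> A = 0"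
  by transfer auto

lemma meas_empty [simp]: "meas \<mu> {} = 0"
proof -
  have "(\<lambda>i::nat. meas \<mu> {}) sums meas \<mu> (\<Union>i::nat. {})"
    by (rule meas_sums) (auto simp: disjoint_family_on_def)
  then have "summable (\<lambda>i::nat. meas \<mu> {})" by (auto simp: sums_iff)
  then show ?thesis by (simp add: summable_const_iff)
qed

lemma meas_Un:
  assumes "A \<in> sets borel_Rp" "B \<in> sets borel_Rp" "A \<inter> B = {}"
  shows "meas \<mu> (A \<union> B) = meas \<mu> A + meas \<mu> B"
proof -
  have "(\<lambda>i. meas \<mu> (binaryset A B i)) sums meas \<mu> (\<Union>i. binaryset A B i)"
    using assms by (intro meas_sums)
      (auto simp: range_binaryset_eq disjoint_family_on_def binaryset_def)
  moreover have "(\<lambda>i. meas \<mu> (binaryset A B i)) sums (meas \<mu> A + meas \<mu> B)"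
    by (rule binaryset_sums) simp
  ultimately show ?thesis
    by (simp add: UN_binaryset_eq sums_unique2)
qed

lemma meas_Diff:
  assumes "A \<in> sets borel_Rp" "B \<in> sets borel_Rp" "B \<subseteq> A"
  shows "meas \<mu> (A - B) = meas \<mu> A - meas \<mu> B"
  using meas_Un[of B "A - B" \<mu>] assms by (auto simp: Un_absorb1)


subsection \<open>Jordan parts, integral and total variation norm\<close>

definition pos_part :: "smeasure \<Rightarrow> real measure"
  where "pos_part \<mu> = measure_of {0..} (sets borel_Rp)
           (\<lambda>A. SUP B\<in>{B \<in> sets borel_Rp. B \<subseteq> A}. ennreal (meas \<mu> B))"

definition neg_part :: "smeasure \<Rightarrow> real measure"
  where "neg_part \<mu> = pos_part (- \<mu>)"

definition sm_integrable :: "smeasure \<Rightarrow> (real \<Rightarrow> real) \<Rightarrow> bool"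
  where "sm_integrable \<mu> f \<longleftrightarrow> integrable (pos_part \<mu>) f \<and> integrable (neg_part \<mu>) f"

definition sm_integral :: "smeasure \<Rightarrow> (real \<Rightarrow> real) \<Rightarrow> real"
  where "sm_integral \<mu> f = integral\<^sup>L (pos_part \<mu>) f - integral\<^sup>L (neg_part \<mu>) f"

lemma sets_pos_part [simp, measurable_cong]: "sets (pos_part \<mu>) = sets borel_Rp"
  and sets_neg_part [simp, measurable_cong]: "sets (neg_part \<mu>) = sets borel_Rp"
proof -
  have *: "sets (pos_part \<mu>) = sets borel_Rp" for \<mu>
    unfolding pos_part_def
    using sets.space_closed[of borel_Rp] sets.sigma_sets_eq[of borel_Rp]
    by (subst sets_measure_of) (auto simp: space_restrict_space)
  show "sets (pos_part \<mu>) = sets borel_Rp" "sets (neg_part \<mu>) = sets borel_Rp"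
    unfolding neg_part_def by (rule *)+
qed

lemma space_pos_part [simp]: "space (pos_part \<mu>) = {0..}"
  and space_neg_part [simp]: "space (neg_part \<mu>) = {0..}"
  using sets_eq_imp_space_eq[OF sets_pos_part[of \<mu>]] sets_eq_imp_space_eq[OF sets_neg_part[of \<mu>]]
  by (auto simp: space_restrict_space)

lemma meas_bounded: "\<exists>K. \<forall>A. \<bar>meas \<mu> A\<bar> \<le> K"
proof (rule ccontr)
  define bad where "bad X \<longleftrightarrow> X \<in> sets borel_Rp \<and>
    (\<forall>K. \<exists>B\<in>sets borel_Rp. B \<subseteq> X \<and> \<bar>meas \<mu> B\<bar> > K)" for X
  assume "\<not> ?thesis"
  then have unb: "\<exists>A. \<bar>meas \<mu> A\<bar> > K" for K by (auto simp: not_le)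
  have bad0: "bad {0..}"
    unfolding bad_def
  proof (intro conjI allI)
    show "{0..} \<in> sets borel_Rp"
      by (metis sets.top space_restrict_space space_borel Int_UNIV_right)
    fix K
    obtain A where A: "\<bar>meas \<mu> A\<bar> > max K 0" using unb by blast
    then have "A \<in> sets borel_Rp" by (metis abs_zero max.strict_boundedE less_irrefl meas_notin)
    moreover from this have "A \<subseteq> {0..}"
      using sets.sets_into_space[of A borel_Rp] by (simp add: space_restrict_space)
    ultimately show "\<exists>B\<in>sets borel_Rp. B \<subseteq> {0..} \<and> \<bar>meas \<mu> B\<bar> > K" using A by auto
  qed
  have step: "\<exists>Y. bad Y \<and> Y \<subseteq> X \<and> \<bar>meas \<mu> (X - Y)\<bar> \<ge> 1" if X: "bad X" for X
  proof -
    obtain B where B: "B \<in> sets borel_Rp" "B \<subseteq> X" "\<bar>meas \<mu> B\<bar> > \<bar>meas \<mu> X\<bar> + 1"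
      using X unfolding bad_def by blast
    have Xs: "X \<in> sets borel_Rp" using X by (simp add: bad_def)
    have D: "meas \<mu> (X - B) = meas \<mu> X - meas \<mu> B" by (rule meas_Diff[OF Xs B(1,2)])
    show ?thesis
    proof (cases "bad B")
      case True
      then show ?thesis using B D by (intro exI[of _ B]) auto
    next
      case False
      then obtain K where K: "\<And>C. C \<in> sets borel_Rp \<Longrightarrow> C \<subseteq> B \<Longrightarrow> \<bar>meas \<mu> C\<bar> \<le> K"
        using B(1) unfolding bad_def by (auto simp: not_less)
      have "bad (X - B)"
        unfolding bad_def
      proof (intro conjI allI)
        show "X - B \<in> sets borel_Rp" using Xs B by auto
        fix L
        obtain C where C: "C \<in> sets borel_Rp" "C \<subseteq> X" "\<bar>meas \<mu> C\<bar> > L + K"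
          using X unfolding bad_def by blast
        have "meas \<mu> C = meas \<mu> (C - B) + meas \<mu> (C \<inter> B)"
          using meas_Un[of "C - B" "C \<inter> B" \<mu>] C B by (auto simp: Un_Diff_Int)
        moreover have "\<bar>meas \<mu> (C \<inter> B)\<bar> \<le> K" using K[of "C \<inter> B"] C B by auto
        ultimately have "\<bar>meas \<mu> (C - B)\<bar> > L" using C(3) by linarith
        then show "\<exists>B'\<in>sets borel_Rp. B' \<subseteq> X - B \<and> L < \<bar>meas \<mu> B'\<bar>"
          using C B by (intro bexI[of _ "C - B"]) auto
      qed
      moreover have "X - (X - B) = B" using B by auto
      ultimately show ?thesis using B by (intro exI[of _ "X - B"]) auto
    qed
  qed
  obtain X where X: "\<And>n. bad (X n)"
      "\<And>n. X (Suc n) \<subseteq> X n \<and> \<bar>meas \<mu> (X n - X (Suc n))\<bar> \<ge> 1"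
    using dependent_nat_choice[of "\<lambda>_. bad" "\<lambda>_ X Y. Y \<subseteq> X \<and> \<bar>meas \<mu> (X - Y)\<bar> \<ge> 1"]
      bad0 step by metis
  have mono: "X n \<subseteq> X m" if "m \<le> n" for m n
    using lift_Suc_antimono_le[of X m n] X(2) that by blast
  have "disjoint_family (\<lambda>n. X n - X (Suc n))"
    unfolding disjoint_family_on_def
  proof (intro ballI impI)
    fix m n :: nat assume "m \<noteq> n"
    then have "X n \<subseteq> X (Suc m) \<or> X m \<subseteq> X (Suc n)"
      using mono[of "Suc m" n] mono[of "Suc n" m] by (cases "m < n") auto
    then show "(X m - X (Suc m)) \<inter> (X n - X (Suc n)) = {}" by auto
  qed
  moreover have "range (\<lambda>n. X n - X (Suc n)) \<subseteq> sets borel_Rp"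
    using X(1) by (auto simp: bad_def)
  ultimately have "(\<lambda>n. meas \<mu> (X n - X (Suc n))) \<longlonglongrightarrow> 0"
    by (intro summable_LIMSEQ_zero sums_summable[OF meas_sums])
  then have "eventually (\<lambda>n. \<bar>meas \<mu> (X n - X (Suc n))\<bar> < 1) sequentially"
    using order_tendstoD(2)[OF tendsto_rabs_zero, of _ sequentially 1] by simp
  then show False using X(2) by (auto simp: eventually_sequentially not_less[symmetric])
qed

lemma emeasure_pos_part:
  assumes "A \<in> sets borel_Rp"
  shows "emeasure (pos_part \<mu>) A = (SUP B\<in>{B \<in> sets borel_Rp. B \<subseteq> A}. ennreal (meas \<mu> B))"
    (is "_ = ?P A")
proof -
  have lower: "ennreal (meas \<mu> B) \<le> ?P A" if "B \<in> sets borel_Rp" "B \<subseteq> A" for A B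
    using that by (intro SUP_upper) auto
  have add: "?P A + ?P B \<le> ?P (A \<union> B)"
    if AB: "A \<in> sets borel_Rp" "B \<in> sets borel_Rp" "A \<inter> B = {}" for A B
  proof -
    let ?S = "\<lambda>A. {B \<in> sets borel_Rp. B \<subseteq> A}"
    have ne: "?S A \<noteq> {}" for A by auto
    have le: "ennreal (meas \<mu> C) + ennreal (meas \<mu> D) \<le> ?P (A \<union> B)"
      if C: "C \<in> ?S A" and D: "D \<in> ?S B" for C D
    proof -
      consider "meas \<mu> C \<ge> 0" "meas \<mu> D \<ge> 0" | "meas \<mu> C \<le> 0" | "meas \<mu> D \<le> 0" by linarith
      then show ?thesis
      proof cases
        case 1
        have "ennreal (meas \<mu> C) + ennreal (meas \<mu> D) = ennreal (meas \<mu> (C \<union> D))"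
          using C D AB 1 by (subst meas_Un) auto
        also have "\<dots> \<le> ?P (A \<union> B)" using C D by (intro lower) auto
        finally show ?thesis .
      next
        case 2
        then show ?thesis using D by (auto simp: ennreal_neg intro!: lower)
      next
        case 3
        then show ?thesis using C by (auto simp: ennreal_neg intro!: lower)
      qed
    qed
    have "?P A + ?P B = (SUP C\<in>?S A. SUP D\<in>?S B. ennreal (meas \<mu> C) + ennreal (meas \<mu> D))"
      unfolding ennreal_SUP_add_left[OF ne[of A], symmetric]
      by (intro SUP_cong refl ennreal_SUP_add_right ne)
    also have "\<dots> \<le> ?P (A \<union> B)" using le by (intro SUP_least) auto
    finally show ?thesis .
  qed
  have "countably_additive (sets borel_Rp) ?P"
  proof (rule countably_additiveI)
    fix A :: "nat \<Rightarrow> real set"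
    assume A: "range A \<subseteq> sets borel_Rp" "disjoint_family A" "(\<Union>i. A i) \<in> sets borel_Rp"
    show "(\<Sum>i. ?P (A i)) = ?P (\<Union>i. A i)"
    proof (rule antisym)
      have "(\<Sum>i<n. ?P (A i)) \<le> ?P (\<Union>i<n. A i)" for n
      proof (induction n)
        case (Suc n)
        have "A n \<inter> (\<Union>i<n. A i) = {}"
          using disjoint_family_onD[OF A(2), of n] by fastforce
        then have "?P (\<Union>i<n. A i) + ?P (A n) \<le> ?P ((\<Union>i<n. A i) \<union> A n)"
          using A(1) by (intro add) auto
        also have "(\<Union>i<n. A i) \<union> A n = (\<Union>i<Suc n. A i)" by (auto simp: less_Suc_eq)
        finally have "?P (\<Union>i<n. A i) + ?P (A n) \<le> ?P (\<Union>i<Suc n. A i)" .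
        with add_right_mono[OF Suc] show ?case
          unfolding sum.lessThan_Suc by (rule order_trans)
      qed simp
      also have "?P (\<Union>i<n. A i) \<le> ?P (\<Union>i. A i)" for n
        by (intro SUP_subset_mono) auto
      finally show "(\<Sum>i. ?P (A i)) \<le> ?P (\<Union>i. A i)"
        by (intro suminf_le_const summableI) auto
    next
      show "?P (\<Union>i. A i) \<le> (\<Sum>i. ?P (A i))"
      proof (intro SUP_least)
        fix B assume "B \<in> {B \<in> sets borel_Rp. B \<subseteq> (\<Union>i. A i)}"
        then have B: "B \<in> sets borel_Rp" "B = (\<Union>i. B \<inter> A i)" by auto
        have s: "(\<lambda>i. meas \<mu> (B \<inter> A i)) sums meas \<mu> B"
        proof (subst (2) B(2), rule meas_sums)
          show "range (\<lambda>i. B \<inter> A i) \<subseteq> sets borel_Rp" using A(1) B(1) by auto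
          show "disjoint_family (\<lambda>i. B \<inter> A i)"
            using A(2) by (rule disjoint_family_on_bisimulation) auto
        qed
        show "ennreal (meas \<mu> B) \<le> (\<Sum>i. ?P (A i))"
        proof (rule LIMSEQ_le_const2)
          show "(\<lambda>n. ennreal (\<Sum>i<n. meas \<mu> (B \<inter> A i))) \<longlonglongrightarrow> ennreal (meas \<mu> B)"
            using s unfolding sums_def by (rule tendsto_ennrealI)
          have "ennreal (\<Sum>i<n. meas \<mu> (B \<inter> A i)) \<le> (\<Sum>i. ?P (A i))" for n
          proof -
            have "ennreal (\<Sum>i<n. meas \<mu> (B \<inter> A i))
                \<le> ennreal (\<Sum>i<n. max 0 (meas \<mu> (B \<inter> A i)))"
              by (intro ennreal_leI sum_mono) auto
            also have "\<dots> = (\<Sum>i<n. ennreal (meas \<mu> (B \<inter> A i)))"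
              unfolding sum_ennreal[OF max.cobounded1, symmetric]
              by (intro sum.cong refl) (simp add: max_def ennreal_neg)
            also have "\<dots> \<le> (\<Sum>i<n. ?P (A i))"
              using A B by (intro sum_mono lower) auto
            also have "\<dots> \<le> (\<Sum>i. ?P (A i))" by (intro sum_le_suminf summableI) auto
            finally show ?thesis .
          qed
          then show "\<exists>N. \<forall>n\<ge>N. ennreal (\<Sum>i<n. meas \<mu> (B \<inter> A i)) \<le> (\<Sum>i. ?P (A i))" by auto
        qed
      qed
    qed
  qed
  moreover have "positive (sets borel_Rp) ?P"
    by (auto simp: positive_def)
  moreover have "sigma_algebra {0..} (sets borel_Rp)"
    using sets.sigma_algebra_axioms[of borel_Rp] by (simp add: space_restrict_space)
  ultimately show ?thesis
    using assms unfolding pos_part_def by (intro emeasure_measure_of_sigma)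
qed

lemma finite_measure_pos_part: "finite_measure (pos_part \<mu>)"
  and finite_measure_neg_part: "finite_measure (neg_part \<mu>)"
proof -
  have *: "finite_measure (pos_part \<mu>)" for \<mu>
  proof
    obtain K where K: "\<And>A. \<bar>meas \<mu> A\<bar> \<le> K" using meas_bounded by blast
    have "{0..} \<in> sets borel_Rp"
      by (metis sets.top space_restrict_space space_borel Int_UNIV_right)
    then have "emeasure (pos_part \<mu>) {0..} \<le> ennreal K"
      by (subst emeasure_pos_part) (auto intro!: SUP_least ennreal_leI order_trans[OF abs_ge_self K])
    then show "emeasure (pos_part \<mu>) (space (pos_part \<mu>)) \<noteq> \<infinity>"
      by (auto simp: top_unique)
  qed
  show "finite_measure (pos_part \<mu>)" "finite_measure (neg_part \<mu>)"
    unfolding neg_part_def by (rule *)+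
qed

lemma meas_eq_pos_minus_neg:
  "meas \<mu> A = measure (pos_part \<mu>) A - measure (neg_part \<mu>) A"
proof (cases "A \<in> sets borel_Rp")
  case False
  then show ?thesis by (simp add: measure_notin_sets)
next
  case A: True
  obtain K where K: "\<And>A. \<bar>meas \<mu> A\<bar> \<le> K" using meas_bounded by blast
  let ?S = "{B \<in> sets borel_Rp. B \<subseteq> A}"
  have S: "measure (pos_part \<nu>) A = (SUP B\<in>?S. meas \<nu> B)" 
    if "\<And>A. \<bar>meas \<nu> A\<bar> \<le> K" for \<nu>
  proof -
    have le: "meas \<nu> B \<le> K" for B using that[of B] by linarith
    then have bdd: "bdd_above (meas \<nu> ` ?S)"
      by (intro bdd_aboveI2[of _ _ K])
    have "0 \<le> (SUP B\<in>?S. meas \<nu> B)"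
      using cSUP_upper[OF _ bdd, of "{}"] by simp
    moreover have "(SUP B\<in>?S. ennreal (meas \<nu> B)) = ennreal (SUP B\<in>?S. meas \<nu> B)"
    proof (rule antisym)
      show "(SUP B\<in>?S. ennreal (meas \<nu> B)) \<le> ennreal (SUP B\<in>?S. meas \<nu> B)"
        using bdd by (intro SUP_least ennreal_leI cSUP_upper)
      show "ennreal (SUP B\<in>?S. meas \<nu> B) \<le> (SUP B\<in>?S. ennreal (meas \<nu> B))" (is "_ \<le> ?R")
      proof -
        have fin: "?R \<le> ennreal K"
          by (intro SUP_least ennreal_leI le)
        then have "?R < top" by (rule le_less_trans) simp
        then have R: "ennreal (enn2real ?R) = ?R" by (rule ennreal_enn2real)
        have "meas \<nu> B \<le> enn2real ?R" if "B \<in> ?S" for B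
        proof (cases "meas \<nu> B \<ge> 0")
          case True
          have "ennreal (meas \<nu> B) \<le> ?R" using that by (intro SUP_upper)
          then have "ennreal (meas \<nu> B) \<le> ennreal (enn2real ?R)" unfolding R .
          then show ?thesis by (subst (asm) ennreal_le_iff) simp_all
        next
          case False
          then show ?thesis by (meson enn2real_nonneg linear order_trans)
        qed
        then have "(SUP B\<in>?S. meas \<nu> B) \<le> enn2real ?R" by (intro cSUP_least) auto
        then have "ennreal (SUP B\<in>?S. meas \<nu> B) \<le> ennreal (enn2real ?R)" by (rule ennreal_leI)
        then show ?thesis unfolding R .
      qed
    qed
    ultimately show ?thesis using A by (simp add: measure_def emeasure_pos_part)
  qed
  have "measure (neg_part \<mu>) A = (SUP B\<in>?S. - meas \<mu> B)"
    unfolding neg_part_def using S[of "- \<mu>"] K by simp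
  also have "(SUP B\<in>?S. - meas \<mu> B) = (SUP B\<in>?S. meas \<mu> B) - meas \<mu> A"
  proof (rule antisym)
    have bdd: "bdd_above (meas \<mu> ` ?S)" "bdd_above ((\<lambda>B. - meas \<mu> B) ` ?S)"
      using order_trans[OF abs_ge_self K] order_trans[OF abs_ge_minus_self K]
      by (intro bdd_aboveI2[of _ _ K]; blast)+
    have D: "meas \<mu> (A - B) = meas \<mu> A - meas \<mu> B" if "B \<in> ?S" for B
      using that A by (intro meas_Diff) auto
    show "(SUP B\<in>?S. - meas \<mu> B) \<le> (SUP B\<in>?S. meas \<mu> B) - meas \<mu> A"
    proof (rule cSUP_least)
      fix B assume B: "B \<in> ?S"
      then have "A - B \<in> ?S" using A by auto
      then have "meas \<mu> (A - B) \<le> (SUP B\<in>?S. meas \<mu> B)" by (rule cSUP_upper[OF _ bdd(1)])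
      then show "- meas \<mu> B \<le> (SUP B\<in>?S. meas \<mu> B) - meas \<mu> A" using D[OF B] by simp
    qed auto
    have "(SUP B\<in>?S. meas \<mu> B) \<le> (SUP B\<in>?S. - meas \<mu> B) + meas \<mu> A"
    proof (rule cSUP_least)
      fix B assume B: "B \<in> ?S"
      then have "A - B \<in> ?S" using A by auto
      then have "- meas \<mu> (A - B) \<le> (SUP B\<in>?S. - meas \<mu> B)" by (rule cSUP_upper[OF _ bdd(2)])
      then show "meas \<mu> B \<le> (SUP B\<in>?S. - meas \<mu> B) + meas \<mu> A" using D[OF B] by simp
    qed auto
    then show "(SUP B\<in>?S. meas \<mu> B) - meas \<mu> A \<le> (SUP B\<in>?S. - meas \<mu> B)" by simp
  qed
  finally show ?thesis using S[OF K] by simp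
qed

text \<open>
  Equality of sums of three measures is what additivity of the integral in the signed measure
  reduces to, since the Jordan parts of a sum are not the sums of the Jordan parts.
\<close>

lemma nn_integral_add3_eq:
  assumes sets: "sets M1 = sets L" "sets M2 = sets L" "sets M3 = sets L"
      "sets N1 = sets L" "sets N2 = sets L" "sets N3 = sets L"
    and eq: "\<And>A. A \<in> sets L \<Longrightarrow> emeasure M1 A + emeasure M2 A + emeasure M3 A =
               emeasure N1 A + emeasure N2 A + emeasure N3 A"
    and f: "f \<in> borel_measurable L"
  shows "nn_integral M1 f + nn_integral M2 f + nn_integral M3 f =
         nn_integral N1 f + nn_integral N2 f + nn_integral N3 f"
proof -
  have space: "space M1 = space L" "space M2 = space L" "space M3 = space L"
      "space N1 = space L" "space N2 = space L" "space N3 = space L"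
    using sets[THEN sets_eq_imp_space_eq] by simp_all
  have meas: "g \<in> borel_measurable M" if "g \<in> borel_measurable L" "sets M = sets L"
    for M and g :: "'a \<Rightarrow> ennreal"
    unfolding measurable_cong_sets[OF that(2) refl] by (rule that(1))
  show ?thesis
    using f
  proof (induction rule: borel_measurable_induct)
    case (cong f g)
    then have "nn_integral M f = nn_integral M g" if "space M = space L" for M
      using that by (intro nn_integral_cong) auto
    then show ?case using cong space by simp
  next
    case (set A)
    then show ?case using eq sets by simp
  next
    case (mult u c)
    have scale: "nn_integral M (\<lambda>x. c * u x) = c * nn_integral M u" if "sets M = sets L" for M
      using meas[OF mult(2) that] by (intro nn_integral_cmult)
    show ?case
      unfolding sets[THEN scale] distrib_left[symmetric] using mult by simp
  next
    case (add u v)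
    have plus: "nn_integral M (\<lambda>x. v x + u x) = nn_integral M v + nn_integral M u"
      if "sets M = sets L" for M
      by (intro nn_integral_add meas[OF _ that] add)
    have ac: "(a + a') + (b + b') + (c + c') = (a + b + c) + (a' + b' + c')" for a a' b b' c c' :: ennreal
      by (simp add: ac_simps)
    show ?case unfolding sets[THEN plus] unfolding ac add.IH ..
  next
    case (seq U)
    have inc: "incseq (\<lambda>i. nn_integral M (U i))" for M
      using seq(3) by (auto simp: incseq_def le_fun_def intro!: nn_integral_mono)
    have SUP: "nn_integral M (SUP i. U i) = (SUP i. nn_integral M (U i))" if "sets M = sets L" for M
    proof -
      have "(SUP i. U i) = (\<lambda>x. SUP i. U i x)" by (simp add: fun_eq_iff image_comp)
      then show ?thesis
        using nn_integral_monotone_convergence_SUP[OF seq(3) meas[OF seq(1) that]] by simp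
    qed
    have add3: "(SUP i. nn_integral M (U i)) + (SUP i. nn_integral M' (U i)) + (SUP i. nn_integral M'' (U i))
        = (SUP i. nn_integral M (U i) + nn_integral M' (U i) + nn_integral M'' (U i))" for M M' M''
    proof -
      have "incseq (\<lambda>i. nn_integral M (U i) + nn_integral M' (U i))"
        using inc[of M] inc[of M'] by (auto simp: incseq_def intro!: add_mono)
      then show ?thesis
        by (simp only: ennreal_SUP_add[OF inc inc] ennreal_SUP_add[OF _ inc])
    qed
    show ?case unfolding sets[THEN SUP] add3 by (intro SUP_cong refl seq.IH)
  qed
qed

lemma integral_add3_eq:
  fixes f :: "'a \<Rightarrow> real"
  assumes sets: "sets M1 = sets L" "sets M2 = sets L" "sets M3 = sets L"
      "sets N1 = sets L" "sets N2 = sets L" "sets N3 = sets L"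
    and fin: "finite_measure M1" "finite_measure M2" "finite_measure M3"
      "finite_measure N1" "finite_measure N2" "finite_measure N3"
    and eq: "\<And>A. A \<in> sets L \<Longrightarrow> measure M1 A + measure M2 A + measure M3 A =
               measure N1 A + measure N2 A + measure N3 A"
    and f: "integrable M1 f" "integrable M2 f" "integrable M3 f"
      "integrable N1 f" "integrable N2 f" "integrable N3 f"
  shows "integral\<^sup>L M1 f + integral\<^sup>L M2 f + integral\<^sup>L M3 f =
         integral\<^sup>L N1 f + integral\<^sup>L N2 f + integral\<^sup>L N3 f"
proof -
  have eq': "emeasure M1 A + emeasure M2 A + emeasure M3 A =
             emeasure N1 A + emeasure N2 A + emeasure N3 A" if "A \<in> sets L" for A
    using eq[OF that] fin
    by (simp add: finite_measure.emeasure_eq_measure ennreal_plus[symmetric] del: ennreal_plus)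
  have fL: "f \<in> borel_measurable L"
    using f(1) measurable_cong_sets[OF sets(1) refl] by (auto dest: borel_measurable_integrable)
  have pos: "integral\<^sup>L M1 g + integral\<^sup>L M2 g + integral\<^sup>L M3 g =
         integral\<^sup>L N1 g + integral\<^sup>L N2 g + integral\<^sup>L N3 g"
    if g: "integrable M1 g" "integrable M2 g" "integrable M3 g"
      "integrable N1 g" "integrable N2 g" "integrable N3 g" "g \<in> borel_measurable L"
      and "\<And>x. g x \<ge> 0" for g :: "'a \<Rightarrow> real"
  proof -
    have nn: "nn_integral M (\<lambda>x. ennreal (g x)) = ennreal (integral\<^sup>L M g)" if "integrable M g" for M
      using that \<open>\<And>x. g x \<ge> 0\<close> by (intro nn_integral_eq_integral) auto
    have "integral\<^sup>L M g \<ge> 0" for M :: "'a measure"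
      using \<open>\<And>x. g x \<ge> 0\<close> by simp
    then show ?thesis
      using nn_integral_add3_eq[OF sets eq', of "\<lambda>x. ennreal (g x)"] g
      by (simp add: nn ennreal_plus[symmetric] del: ennreal_plus)
  qed
  have split: "integral\<^sup>L M f = integral\<^sup>L M (\<lambda>x. max 0 (f x)) - integral\<^sup>L M (\<lambda>x. max 0 (- f x))"
    if "integrable M f" for M
  proof -
    have "integral\<^sup>L M f = integral\<^sup>L M (\<lambda>x. max 0 (f x) - max 0 (- f x))"
      by (intro Bochner_Integration.integral_cong) (auto simp: max_def)
    also have "\<dots> = integral\<^sup>L M (\<lambda>x. max 0 (f x)) - integral\<^sup>L M (\<lambda>x. max 0 (- f x))"
      using that by (intro Bochner_Integration.integral_diff) auto
    finally show ?thesis .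
  qed
  show ?thesis
    using pos[of "\<lambda>x. max 0 (f x)"] pos[of "\<lambda>x. max 0 (- f x)"] f fL
    by (simp add: split)
qed

lemma finite_measure_integrable_bounded:
  fixes f :: "real \<Rightarrow> real"
  assumes "finite_measure M" "sets M = sets borel_Rp" "f \<in> borel_measurable borel_Rp"
    and "\<And>x. x \<ge> 0 \<Longrightarrow> \<bar>f x\<bar> \<le> K"
  shows "integrable M f"
proof (rule finite_measure.integrable_const_bound[OF assms(1), of _ K])
  show "AE x in M. norm (f x) \<le> K"
    using assms sets_eq_imp_space_eq[OF assms(2)] by (intro AE_I2) (auto simp: space_restrict_space)
  show "f \<in> borel_measurable M" using assms(3) measurable_cong_sets[OF assms(2) refl] by auto
qed

lemma sm_integrable_bounded:
  assumes "f \<in> borel_measurable borel_Rp" "\<And>x. x \<ge> 0 \<Longrightarrow> \<bar>f x\<bar> \<le> K"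
  shows "sm_integrable \<mu> f"
  unfolding sm_integrable_def using assms
  by (intro conjI finite_measure_integrable_bounded finite_measure_pos_part finite_measure_neg_part)
    auto

lemma sm_integral_indicator:
  assumes "A \<in> sets borel_Rp"
  shows "sm_integral \<mu> (indicator A) = meas \<mu> A"
proof -
  have "A \<subseteq> {0..}" using sets.sets_into_space[OF assms] by (simp add: space_restrict_space)
  then show ?thesis
    using assms by (simp add: sm_integral_def meas_eq_pos_minus_neg Int_absorb2)
qed

lemma sm_integral_plus_measure:
  assumes "sm_integrable \<mu> f" "sm_integrable \<nu> f" "sm_integrable (\<mu> + \<nu>) f"
  shows "sm_integral (\<mu> + \<nu>) f = sm_integral \<mu> f + sm_integral \<nu> f"
proof -
  have "integral\<^sup>L (pos_part (\<mu> + \<nu>)) f + integral\<^sup>L (neg_part \<mu>) f + integral\<^sup>L (neg_part \<nu>) f =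
        integral\<^sup>L (neg_part (\<mu> + \<nu>)) f + integral\<^sup>L (pos_part \<mu>) f + integral\<^sup>L (pos_part \<nu>) f"
  proof (rule integral_add3_eq[where L=borel_Rp])
    fix A
    show "measure (pos_part (\<mu> + \<nu>)) A + measure (neg_part \<mu>) A + measure (neg_part \<nu>) A =
      measure (neg_part (\<mu> + \<nu>)) A + measure (pos_part \<mu>) A + measure (pos_part \<nu>) A"
      using meas_eq_pos_minus_neg[of "\<mu> + \<nu>" A] meas_eq_pos_minus_neg[of \<mu> A]
        meas_eq_pos_minus_neg[of \<nu> A] by simp
  qed (use assms in \<open>auto simp: sm_integrable_def finite_measure_pos_part finite_measure_neg_part\<close>)
  then show ?thesis by (simp add: sm_integral_def)
qed

lemma sm_integral_uminus_measure: "sm_integral (- \<mu>) f = - sm_integral \<mu> f"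
  by (simp add: sm_integral_def neg_part_def)

lemma sm_integrable_uminus_measure: "sm_integrable (- \<mu>) f \<longleftrightarrow> sm_integrable \<mu> f"
  by (auto simp: sm_integrable_def neg_part_def)

lemma sm_integral_scaleR_measure: "sm_integral (c *\<^sub>R \<mu>) f = c * sm_integral \<mu> f"
proof -
  have pos: "pos_part (c *\<^sub>R \<mu>) = density (pos_part \<mu>) (\<lambda>_. ennreal c)" if "c \<ge> 0" for c \<mu>
  proof (rule measure_eqI)
    fix A assume "A \<in> sets (pos_part (c *\<^sub>R \<mu>))"
    then have A: "A \<in> sets borel_Rp" by simp
    have "(SUP B\<in>{B \<in> sets borel_Rp. B \<subseteq> A}. ennreal (c * meas \<mu> B)) =
        ennreal c * (SUP B\<in>{B \<in> sets borel_Rp. B \<subseteq> A}. ennreal (meas \<mu> B))"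
      using that by (simp add: ennreal_mult' SUP_mult_left_ennreal)
    then show "emeasure (pos_part (c *\<^sub>R \<mu>)) A = emeasure (density (pos_part \<mu>) (\<lambda>_. ennreal c)) A"
      using A by (simp add: emeasure_pos_part emeasure_density nn_integral_cmult)
  qed simp
  have nonneg: "sm_integral (c *\<^sub>R \<mu>) f = c * sm_integral \<mu> f" if "c \<ge> 0" for c \<mu>
  proof -
    have *: "integral\<^sup>L (density M (\<lambda>_. ennreal c)) f = c * integral\<^sup>L M f" for M :: "real measure"
    proof (cases "f \<in> borel_measurable M")
      case True
      then show ?thesis using that by (subst integral_density) auto
    next
      case False
      then have "\<not> integrable M f" "\<not> integrable (density M (\<lambda>_. ennreal c)) f"
        by (auto dest: borel_measurable_integrable)
      then show ?thesis by (simp add: not_integrable_integral_eq)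
    qed
    have "neg_part (c *\<^sub>R \<mu>) = density (neg_part \<mu>) (\<lambda>_. ennreal c)"
      unfolding neg_part_def scaleR_minus_right[symmetric] using that by (rule pos)
    then show ?thesis
      using that by (simp add: sm_integral_def pos * right_diff_distrib)
  qed
  show ?thesis
  proof (cases "c \<ge> 0")
    case False
    then have "sm_integral (- ((- c) *\<^sub>R \<mu>)) f = c * sm_integral \<mu> f"
      by (subst sm_integral_uminus_measure, subst nonneg) auto
    then show ?thesis by simp
  qed (rule nonneg)
qed

instantiation smeasure :: real_normed_vector
begin

text \<open>
  The norm is the total variation norm; \<^const>\<open>sm_integrable\<close> is integrability for the variation
  \<open>pos_part \<mu> + neg_part \<mu>\<close>.
\<close>

definition norm_smeasure :: "smeasure \<Rightarrow> real"
  where "norm_smeasure \<mu> = Sup {sm_integral \<mu> \<phi> | \<phi>.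
           continuous_on {0..} \<phi> \<and> sm_integrable \<mu> \<phi> \<and> (\<forall>x\<ge>0. \<bar>\<phi> x\<bar> \<le> 1)}"

definition sgn_smeasure :: "smeasure \<Rightarrow> smeasure"
  where "sgn_smeasure \<mu> = inverse (norm \<mu>) *\<^sub>R \<mu>"

definition dist_smeasure :: "smeasure \<Rightarrow> smeasure \<Rightarrow> real"
  where "dist_smeasure \<mu> \<nu> = norm (\<mu> - \<nu>)"

definition uniformity_smeasure :: "(smeasure \<times> smeasure) filter"
  where "uniformity_smeasure = (INF e\<in>{0 <..}. principal {(\<mu>, \<nu>). dist \<mu> \<nu> < e})"

definition open_smeasure :: "smeasure set \<Rightarrow> bool"
  where "open_smeasure U \<longleftrightarrow> (\<forall>\<mu>\<in>U. eventually (\<lambda>(\<mu>', \<nu>). \<mu>' = \<mu> \<longrightarrow> \<nu> \<in> U) uniformity)"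

instance
proof
  define T :: "(real \<Rightarrow> real) set"
    where "T = {\<phi>. continuous_on {0..} \<phi> \<and> (\<forall>x\<ge>0. \<bar>\<phi> x\<bar> \<le> 1)}"
  have int: "sm_integrable \<mu> \<phi>" if "\<phi> \<in> T" for \<mu> \<phi>
    using that unfolding T_def
    by (intro sm_integrable_bounded[of _ 1] borel_measurable_continuous_on_restrict) auto
  have norm_eq: "norm \<mu> = (SUP \<phi>\<in>T. sm_integral \<mu> \<phi>)" for \<mu>
    using int unfolding norm_smeasure_def T_def by (intro arg_cong[where f=Sup]) blast
  have T0: "(\<lambda>_. 0) \<in> T" by (auto simp: T_def)
  have bdd: "bdd_above (sm_integral \<mu> ` T)" for \<mu>
  proof (rule bdd_aboveI2)
    fix \<phi> assume \<phi>: "\<phi> \<in> T"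
    have *: "\<bar>integral\<^sup>L M \<phi>\<bar> \<le> measure M {0..}"
      if "finite_measure M" "space M = {0..}" "integrable M \<phi>" for M
    proof -
      have "\<bar>integral\<^sup>L M \<phi>\<bar> \<le> integral\<^sup>L M (\<lambda>x. \<bar>\<phi> x\<bar>)" using integral_norm_bound[of M \<phi>] by simp
      also have "\<dots> \<le> integral\<^sup>L M (\<lambda>x. 1)"
        using that \<phi> finite_measure.integrable_const[OF that(1), of "1::real"]
        by (intro integral_mono) (auto simp: T_def)
      finally show ?thesis using that by simp
    qed
    show "sm_integral \<mu> \<phi> \<le> measure (pos_part \<mu>) {0..} + measure (neg_part \<mu>) {0..}"
      using *[OF finite_measure_pos_part[of \<mu>]] *[OF finite_measure_neg_part[of \<mu>]] int[OF \<phi>, of \<mu>]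
      by (auto simp: sm_integral_def sm_integrable_def)
  qed
  have upper: "sm_integral \<mu> \<phi> \<le> norm \<mu>" if "\<phi> \<in> T" for \<mu> \<phi>
    unfolding norm_eq by (rule cSUP_upper[OF that bdd])
  have nonneg: "norm \<mu> \<ge> 0" for \<mu> :: smeasure
    using upper[OF T0, of \<mu>] by (simp add: sm_integral_def)
  have least: "norm \<mu> \<le> K" if "\<And>\<phi>. \<phi> \<in> T \<Longrightarrow> sm_integral \<mu> \<phi> \<le> K" for \<mu> K
    unfolding norm_eq using T0 that by (intro cSUP_least) auto
  fix \<mu> \<nu> :: smeasure and c :: real and U :: "smeasure set"
  show "dist \<mu> \<nu> = norm (\<mu> - \<nu>)" by (rule dist_smeasure_def)
  show "sgn \<mu> = inverse (norm \<mu>) *\<^sub>R \<mu>" by (rule sgn_smeasure_def)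
  show "(uniformity :: (smeasure \<times> smeasure) filter) = (INF e\<in>{0 <..}. principal {(\<mu>, \<nu>). dist \<mu> \<nu> < e})"
    by (rule uniformity_smeasure_def)
  show "open U \<longleftrightarrow> (\<forall>\<mu>\<in>U. eventually (\<lambda>(\<mu>', \<nu>). \<mu>' = \<mu> \<longrightarrow> \<nu> \<in> U) uniformity)"
    by (rule open_smeasure_def)
  show "norm (\<mu> + \<nu>) \<le> norm \<mu> + norm \<nu>"
    using upper by (intro least) (auto simp: sm_integral_plus_measure int intro!: add_mono)
  have scale: "norm (c *\<^sub>R \<mu>) \<le> \<bar>c\<bar> * norm \<mu>" for c and \<mu> :: smeasure
  proof (rule least)
    fix \<phi> assume \<phi>: "\<phi> \<in> T"
    then have \<phi>': "(\<lambda>x. - \<phi> x) \<in> T" by (auto simp: T_def intro!: continuous_intros)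
    have "sm_integral \<mu> (\<lambda>x. - \<phi> x) = - sm_integral \<mu> \<phi>" by (simp add: sm_integral_def)
    then have "\<bar>sm_integral \<mu> \<phi>\<bar> \<le> norm \<mu>"
      using upper[OF \<phi>, of \<mu>] upper[OF \<phi>', of \<mu>] by simp
    then have "\<bar>c * sm_integral \<mu> \<phi>\<bar> \<le> \<bar>c\<bar> * norm \<mu>"
      by (simp add: abs_mult mult_left_mono)
    then show "sm_integral (c *\<^sub>R \<mu>) \<phi> \<le> \<bar>c\<bar> * norm \<mu>"
      by (simp add: sm_integral_scaleR_measure)
  qed
  show "norm (c *\<^sub>R \<mu>) = \<bar>c\<bar> * norm \<mu>"
  proof (cases "c = 0")
    case True
    then show ?thesis using scale[of 0 \<mu>] nonneg[of "0 *\<^sub>R \<mu>"] by simp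
  next
    case False
    have "\<bar>c\<bar> * norm \<mu> = \<bar>c\<bar> * norm (inverse c *\<^sub>R (c *\<^sub>R \<mu>))" using False by simp
    also have "\<dots> \<le> \<bar>c\<bar> * (\<bar>inverse c\<bar> * norm (c *\<^sub>R \<mu>))"
      by (intro mult_left_mono scale) auto
    also have "\<dots> = norm (c *\<^sub>R \<mu>)" using False by (simp add: abs_inverse)
    finally show ?thesis using scale[of c \<mu>] by simp
  qed
  have "\<mu> = 0" if 0: "norm \<mu> = 0"
  proof -
    have zero: "sm_integral \<mu> \<phi> = 0" if \<phi>: "\<phi> \<in> T" for \<phi>
    proof -
      from \<phi> have \<phi>': "(\<lambda>x. - \<phi> x) \<in> T" by (auto simp: T_def intro!: continuous_intros)
      have "sm_integral \<mu> (\<lambda>x. - \<phi> x) = - sm_integral \<mu> \<phi>" by (simp add: sm_integral_def)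
      then show ?thesis using upper[OF \<phi>, of \<mu>] upper[OF \<phi>', of \<mu>] 0 by simp
    qed
    have Icc: "meas \<mu> {0..a} = 0" for a
    proof -
      define \<phi> where "\<phi> n x = max 0 (min 1 (1 - real n * (x - a)))" for n x
      have \<phi>T: "\<phi> n \<in> T" for n
        unfolding \<phi>_def T_def by (auto intro!: continuous_intros)
      have \<phi>lim: "(\<lambda>n. \<phi> n x) \<longlonglongrightarrow> indicator {..a} x" for x
      proof (cases "x \<le> a")
        case True
        then have "\<phi> n x = 1" for n by (simp add: \<phi>_def mult_nonneg_nonpos)
        then show ?thesis using True by simp
      next
        case False
        obtain N :: nat where N: "1 / (x - a) < N" using reals_Archimedean2 by blast
        have "\<phi> n x = 0" if "n \<ge> N" for n
        proof -
          have "1 / (x - a) < n" using N that by linarith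
          then have "1 < n * (x - a)" using False by (simp add: divide_less_eq)
          then show ?thesis by (simp add: \<phi>_def)
        qed
        then have "eventually (\<lambda>n. \<phi> n x = 0) sequentially" by (auto simp: eventually_sequentially)
        then show ?thesis using False by (simp add: tendsto_eventually)
      qed
      have ind: "(indicator {..a} :: real \<Rightarrow> real) \<in> borel_measurable borel_Rp"
        by (intro measurable_restrict_space1) auto
      have lim: "(\<lambda>n. integral\<^sup>L M (\<phi> n)) \<longlonglongrightarrow> integral\<^sup>L M (indicator {..a})"
        if M: "finite_measure M" "sets M = sets borel_Rp" for M
      proof (rule integral_dominated_convergence[where w = "\<lambda>_. 1"])
        show "integrable M (\<lambda>_. 1 :: real)" using M(1) by (rule finite_measure.integrable_const)
        show "(indicator {..a} :: real \<Rightarrow> real) \<in> borel_measurable M" using ind M(2) by (simp cong: measurable_cong_sets)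
        show "\<phi> n \<in> borel_measurable M" for n
          using borel_measurable_continuous_on_restrict[of "{0..}" "\<phi> n"] \<phi>T[of n] M(2)
          by (simp add: T_def cong: measurable_cong_sets)
      qed (use \<phi>lim in \<open>auto simp: \<phi>_def\<close>)
      have "(\<lambda>n. sm_integral \<mu> (\<phi> n)) \<longlonglongrightarrow> sm_integral \<mu> (indicator {..a})"
        unfolding sm_integral_def
        by (intro tendsto_diff lim finite_measure_pos_part finite_measure_neg_part) auto
      then have "sm_integral \<mu> (indicator {..a}) = 0"
        using zero[OF \<phi>T] by (simp add: LIMSEQ_const_iff)
      moreover have "{..a} \<inter> {0..} = {0..a}" by auto
      ultimately show ?thesis by (simp add: sm_integral_def meas_eq_pos_minus_neg)
    qed
    have "pos_part \<mu> = neg_part \<mu>"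
    proof (rule measure_eqI_generator_eq[where \<Omega> = "{0..}" and E = "range (\<lambda>a. {0..a})"
            and A = "\<lambda>n. {0..real n}"])
      show "Int_stable (range (\<lambda>a::real. {0..a}))"
        unfolding Int_stable_def by (auto simp: Int_atLeastAtMost)
      have b: "sets (borel :: real measure) = sigma_sets UNIV (range (\<lambda>a. {..a}))"
        by (subst borel_eq_atMost) simp
      have "{0..} \<in> sigma_sets UNIV (range (\<lambda>a::real. {..a}))"
        unfolding b[symmetric] by simp
      from sigma_sets_Int[OF this]
      have "sets borel_Rp = sigma_sets {0..} ((\<inter>) {0..} ` range (\<lambda>a::real. {..a}))"
        by (simp add: sets_restrict_space b)
      also have "(\<inter>) {0..} ` range (\<lambda>a::real. {..a}) = range (\<lambda>a. {0..a})"
        by (auto simp: atLeastAtMost_def)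
      finally have "sets borel_Rp = sigma_sets {0..} (range (\<lambda>a::real. {0..a}))" .
      then show "sets (pos_part \<mu>) = sigma_sets {0..} (range (\<lambda>a::real. {0..a}))"
        "sets (neg_part \<mu>) = sigma_sets {0..} (range (\<lambda>a::real. {0..a}))" by simp_all
      show "(\<Union>i. {0..real i}) = {0..}" by (auto intro: real_arch_simple)
      fix X :: "real set" assume "X \<in> range (\<lambda>a. {0..a})"
      then have "measure (pos_part \<mu>) X = measure (neg_part \<mu>) X"
        using Icc meas_eq_pos_minus_neg[of \<mu>] by auto
      then show "emeasure (pos_part \<mu>) X = emeasure (neg_part \<mu>) X"
        by (simp add: finite_measure.emeasure_eq_measure finite_measure_pos_part finite_measure_neg_part)
    next
      show "emeasure (pos_part \<mu>) {0..real i} \<noteq> \<infinity>" for i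
        by (simp add: finite_measure.emeasure_eq_measure finite_measure_pos_part)
    qed auto
    then show ?thesis by (intro smeasure_eqI) (simp add: meas_eq_pos_minus_neg[of \<mu>])
  qed
  moreover have "norm (0 :: smeasure) = 0" using scale[of 0 0] nonneg[of 0] by simp
  ultimately show "norm \<mu> = 0 \<longleftrightarrow> \<mu> = 0" by auto
qed

end


subsection \<open>Operations on signed measures\<close>

lemma meas_Abs_smeasure:
  assumes "\<And>A. A \<notin> sets borel_Rp \<Longrightarrow> F A = 0"
    and "\<And>A :: nat \<Rightarrow> real set. range A \<subseteq> sets borel_Rp \<Longrightarrow> disjoint_family A \<Longrightarrow>
           (\<lambda>i. F (A i)) sums F (\<Union>i. A i)"
  shows "meas (Abs_smeasure F) A = F A"
  using assms by (subst Abs_smeasure_inverse) auto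

lemma sm_integral_dominated_convergence:
  assumes "\<And>n. f n \<in> borel_measurable borel_Rp" "g \<in> borel_measurable borel_Rp"
    and "\<And>x. x \<ge> 0 \<Longrightarrow> (\<lambda>n. f n x) \<longlonglongrightarrow> g x"
    and "\<And>n x. x \<ge> 0 \<Longrightarrow> \<bar>f n x\<bar> \<le> w x" "sm_integrable \<mu> w"
  shows "(\<lambda>n. sm_integral \<mu> (f n)) \<longlonglongrightarrow> sm_integral \<mu> g"
proof -
  have "(\<lambda>n. integral\<^sup>L M (f n)) \<longlonglongrightarrow> integral\<^sup>L M g"
    if M: "sets M = sets borel_Rp" "integrable M w" for M
  proof (rule integral_dominated_convergence[where w = w])
    have "space M = {0..}" using sets_eq_imp_space_eq[OF M(1)] by (simp add: space_restrict_space)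
    then show "AE x in M. (\<lambda>n. f n x) \<longlonglongrightarrow> g x" "AE x in M. norm (f n x) \<le> w x" for n
      using assms(3,4) by (auto intro!: AE_I2)
  qed (use assms(1,2) M measurable_cong_sets[OF M(1) refl] in auto)
  then show ?thesis
    using assms(5) unfolding sm_integral_def sm_integrable_def by (intro tendsto_diff) auto
qed

lemma sm_integral_add:
  "sm_integrable \<mu> f \<Longrightarrow> sm_integrable \<mu> g \<Longrightarrow>
     sm_integral \<mu> (\<lambda>x. f x + g x) = sm_integral \<mu> f + sm_integral \<mu> g"
  by (simp add: sm_integral_def sm_integrable_def)

lemma sm_integral_sum:
  assumes "finite I" "\<And>i. i \<in> I \<Longrightarrow> sm_integrable \<mu> (f i)"
  shows "sm_integral \<mu> (\<lambda>x. \<Sum>i\<in>I. f i x) = (\<Sum>i\<in>I. sm_integral \<mu> (f i))"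
  using assms by (simp add: sm_integral_def sm_integrable_def sum_subtractf)

lemma sum_indicator_disjoint:
  assumes "disjoint_family A"
  shows "(\<Sum>i<n::nat. indicator (A i) x :: real) = indicator (\<Union>i<n. A i) x"
proof (induction n)
  case (Suc n)
  have "A n \<inter> (\<Union>i<n. A i) = {}" using disjoint_family_onD[OF assms, of n] by fastforce
  moreover have "(\<Union>i<Suc n. A i) = A n \<union> (\<Union>i<n. A i)" by (auto simp: less_Suc_eq)
  ultimately show ?case using Suc by (auto simp: indicator_def)
qed simp

lemma sm_measurable_indicator:
  "A \<in> sets borel_Rp \<Longrightarrow> (indicator A :: real \<Rightarrow> real) \<in> borel_measurable borel_Rp"
  by simp

lemma measurable_times_Rp:
  "(\<lambda>(y, x). x * y) \<in> borel_Rp \<Otimes>\<^sub>M borel_Rp \<rightarrow>\<^sub>M borel_Rp"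
proof (rule measurable_restrict_space2)
  show "(\<lambda>(y, x). x * y) \<in> space (borel_Rp \<Otimes>\<^sub>M borel_Rp) \<rightarrow> {0..}"
    by (auto simp: space_pair_measure space_restrict_space)
  have id: "(\<lambda>x. x) \<in> borel_Rp \<rightarrow>\<^sub>M (borel :: real measure)"
    by (rule measurable_restrict_space1) simp
  have "fst \<in> borel_Rp \<Otimes>\<^sub>M borel_Rp \<rightarrow>\<^sub>M (borel :: real measure)"
    "snd \<in> borel_Rp \<Otimes>\<^sub>M borel_Rp \<rightarrow>\<^sub>M (borel :: real measure)"
    using measurable_compose[OF measurable_fst id] measurable_compose[OF measurable_snd id] by auto
  then show "(\<lambda>(y, x). x * y) \<in> borel_measurable (borel_Rp \<Otimes>\<^sub>M borel_Rp)"
    unfolding split_beta' by (intro borel_measurable_times)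
qed

lift_definition dirac :: "real \<Rightarrow> smeasure"
  is "\<lambda>x A. if A \<in> sets borel_Rp then indicator A x else 0"
proof (intro conjI allI impI)
  fix x :: real and A :: "nat \<Rightarrow> real set"
  assume A: "range A \<subseteq> sets borel_Rp" "disjoint_family A"
  have "(\<lambda>n. indicator (\<Union>i<n. A i) x :: real) \<longlonglongrightarrow> indicator (\<Union>i. A i) x"
    by (rule LIMSEQ_indicator_UN)
  then have "(\<lambda>i. indicator (A i) x :: real) sums indicator (\<Union>i. A i) x"
    by (simp add: sums_def sum_indicator_disjoint[OF A(2)])
  moreover have "A i \<in> sets borel_Rp" for i using A(1) by auto
  moreover have "(\<Union>i. A i) \<in> sets borel_Rp" using A(1) by auto
  ultimately show "(\<lambda>i. if A i \<in> sets borel_Rp then indicator (A i) x else 0 :: real)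
      sums (if (\<Union>i. A i) \<in> sets borel_Rp then indicator (\<Union>i. A i) x else 0)" by simp
qed simp

text \<open>
  Multiplication by a function; the result is by convention \<open>0\<close> if \<open>f\<close> is not integrable for
  \<open>\<mu>\<close>, where the product would not be a finite signed measure.
\<close>

definition weight :: "(real \<Rightarrow> real) \<Rightarrow> smeasure \<Rightarrow> smeasure"
  where "weight f \<mu> = Abs_smeasure (\<lambda>A. if A \<in> sets borel_Rp \<and> sm_integrable \<mu> f
           then sm_integral \<mu> (\<lambda>x. indicator A x * f x) else 0)"

lemma meas_weight:
  assumes f: "sm_integrable \<mu> f" and A: "A \<in> sets borel_Rp"
  shows "meas (weight f \<mu>) A = sm_integral \<mu> (\<lambda>x. indicator A x * f x)"
proof -
  have fm: "f \<in> borel_measurable borel_Rp"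
    using f measurable_cong_sets[OF sets_pos_part refl]
    by (auto simp: sm_integrable_def dest: borel_measurable_integrable)
  have ind: "sm_integrable \<mu> (\<lambda>x. indicator A x * f x)" if "A \<in> sets borel_Rp" for A
    using f that unfolding sm_integrable_def by (auto intro!: integrable_real_mult_indicator simp: mult.commute)
  let ?F = "\<lambda>A. if A \<in> sets borel_Rp \<and> sm_integrable \<mu> f
           then sm_integral \<mu> (\<lambda>x. indicator A x * f x) else 0"
  have "meas (weight f \<mu>) A = ?F A"
    unfolding weight_def
  proof (rule meas_Abs_smeasure)
    fix A :: "nat \<Rightarrow> real set" assume A: "range A \<subseteq> sets borel_Rp" "disjoint_family A"
    have "(\<lambda>n. sm_integral \<mu> (\<lambda>x. indicator (\<Union>i<n. A i) x * f x))
        \<longlonglongrightarrow> sm_integral \<mu> (\<lambda>x. indicator (\<Union>i. A i) x * f x)"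
    proof (rule sm_integral_dominated_convergence[where w = "\<lambda>x. \<bar>f x\<bar>"])
      show "sm_integrable \<mu> (\<lambda>x. \<bar>f x\<bar>)" using f by (simp add: sm_integrable_def)
      show "(\<lambda>n. indicator (\<Union>i<n. A i) x * f x) \<longlonglongrightarrow> indicator (\<Union>i. A i) x * f x" for x
        by (intro tendsto_mult LIMSEQ_indicator_UN tendsto_const)
      have m: "(\<lambda>x. indicator B x * f x) \<in> borel_measurable borel_Rp" if "B \<in> sets borel_Rp" for B
        using fm that by (intro borel_measurable_times sm_measurable_indicator)
      show "(\<lambda>x. indicator (\<Union>i<n. A i) x * f x) \<in> borel_measurable borel_Rp"
        "(\<lambda>x. indicator (\<Union>i. A i) x * f x) \<in> borel_measurable borel_Rp" for n
        using A(1) by (auto intro!: m)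
    qed (auto simp: indicator_def)
    also have "(\<lambda>n. sm_integral \<mu> (\<lambda>x. indicator (\<Union>i<n. A i) x * f x)) =
        (\<lambda>n. \<Sum>i<n. sm_integral \<mu> (\<lambda>x. indicator (A i) x * f x))"
    proof
      fix n
      have eq: "(\<lambda>x. indicator (\<Union>i<n. A i) x * f x) = (\<lambda>x. \<Sum>i<n. indicator (A i) x * f x)"
        by (simp add: sum_indicator_disjoint[OF A(2)] flip: sum_distrib_right)
      show "sm_integral \<mu> (\<lambda>x. indicator (\<Union>i<n. A i) x * f x) =
          (\<Sum>i<n. sm_integral \<mu> (\<lambda>x. indicator (A i) x * f x))"
        unfolding eq using A(1) by (intro sm_integral_sum ind) auto
    qed
    finally have "(\<lambda>i. sm_integral \<mu> (\<lambda>x. indicator (A i) x * f x)) sums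
        sm_integral \<mu> (\<lambda>x. indicator (\<Union>i. A i) x * f x)"
      unfolding sums_def .
    moreover have "A i \<in> sets borel_Rp" for i using A(1) by auto
    moreover have "(\<Union>i. A i) \<in> sets borel_Rp" using A(1) by auto
    ultimately show "(\<lambda>i. ?F (A i)) sums ?F (\<Union>i. A i)" using f by simp
  qed auto
  then show ?thesis using assms by simp
qed

text \<open>
  The Mellin convolution is the image of the product measure under multiplication;
  \<open>sm_integral_mellin_conv\<close> below is its characterisation by test functions.
\<close>

definition mellin_conv :: "smeasure \<Rightarrow> smeasure \<Rightarrow> smeasure"  (infixl "\<star>" 70)
  where "\<mu> \<star> \<nu> = Abs_smeasure (\<lambda>A. if A \<in> sets borel_Rp
           then sm_integral \<nu> (\<lambda>y. sm_integral \<mu> (\<lambda>x. indicator A (x * y))) else 0)"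

lemma measurable_times_fun:
  assumes f: "f \<in> borel_measurable borel_Rp"
  shows "(\<lambda>(y, x). f (x * y) :: real) \<in> borel_measurable (borel_Rp \<Otimes>\<^sub>M borel_Rp)"
  using measurable_compose[OF measurable_times_Rp f] by (simp add: split_beta')

lemma measurable_times_slice:
  assumes f: "f \<in> borel_measurable borel_Rp" and y: "y \<ge> 0"
  shows "(\<lambda>x. f (x * y) :: real) \<in> borel_measurable borel_Rp"
  using measurable_compose_Pair1[OF _ measurable_times_fun[OF f], of y] y
  by (simp add: space_restrict_space)

lemma measurable_inner_integral:
  assumes f: "f \<in> borel_measurable borel_Rp"
  shows "(\<lambda>y. sm_integral \<mu> (\<lambda>x. f (x * y) :: real)) \<in> borel_measurable borel_Rp"
proof -
  have "(\<lambda>y. \<integral>x. f (x * y) \<partial>M) \<in> borel_measurable borel_Rp"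
    if M: "finite_measure M" "sets M = sets borel_Rp" for M
  proof -
    interpret finite_measure M by fact
    have "sets (borel_Rp \<Otimes>\<^sub>M M) = sets (borel_Rp \<Otimes>\<^sub>M borel_Rp)"
      using M(2) by (intro sets_pair_measure_cong) auto
    then have "(\<lambda>(y, x). f (x * y)) \<in> borel_measurable (borel_Rp \<Otimes>\<^sub>M M)"
      using measurable_times_fun[OF f] measurable_cong_sets[OF _ refl] by blast
    then show ?thesis by (rule borel_measurable_lebesgue_integral)
  qed
  then show ?thesis
    unfolding sm_integral_def
    by (intro borel_measurable_diff)
      (metis finite_measure_pos_part sets_pos_part, metis finite_measure_neg_part sets_neg_part)
qed

lemma sm_integral_bound:
  "\<exists>K\<ge>0. \<forall>f c. c \<ge> 0 \<longrightarrow> (\<forall>x\<ge>0. \<bar>f x\<bar> \<le> c) \<longrightarrow> \<bar>sm_integral \<mu> f\<bar> \<le> K * c"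
proof (intro exI conjI allI impI)
  let ?K = "measure (pos_part \<mu>) {0..} + measure (neg_part \<mu>) {0..}"
  show "0 \<le> ?K" by simp
  fix f :: "real \<Rightarrow> real" and c :: real assume c: "c \<ge> 0" and f: "\<forall>x\<ge>0. \<bar>f x\<bar> \<le> c"
  have *: "\<bar>integral\<^sup>L M f\<bar> \<le> measure M {0..} * c" if M: "finite_measure M" "space M = {0..}" for M
  proof (cases "integrable M f")
    case True
    have "\<bar>integral\<^sup>L M f\<bar> \<le> integral\<^sup>L M (\<lambda>x. \<bar>f x\<bar>)" using integral_norm_bound[of M f] by simp
    also have "\<dots> \<le> integral\<^sup>L M (\<lambda>x. c)"
      using True M f finite_measure.integrable_const[OF M(1), of c] by (intro integral_mono) auto
    finally show ?thesis using M by simp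
  qed (use c in \<open>simp add: not_integrable_integral_eq\<close>)
  show "\<bar>sm_integral \<mu> f\<bar> \<le> ?K * c"
    using *[OF finite_measure_pos_part[of \<mu>]] *[OF finite_measure_neg_part[of \<mu>]]
    by (simp add: sm_integral_def distrib_right)
qed

lemma meas_mellin_conv:
  assumes A: "A \<in> sets borel_Rp"
  shows "meas (\<mu> \<star> \<nu>) A = sm_integral \<nu> (\<lambda>y. sm_integral \<mu> (\<lambda>x. indicator A (x * y)))"
proof -
  let ?h = "\<lambda>A y. sm_integral \<mu> (\<lambda>x. indicator A (x * y))"
  let ?F = "\<lambda>A. if A \<in> sets borel_Rp then sm_integral \<nu> (?h A) else 0"
  obtain K where K: "K \<ge> 0" "\<And>f c. c \<ge> 0 \<Longrightarrow> (\<And>x. x \<ge> 0 \<Longrightarrow> \<bar>f x\<bar> \<le> c) \<Longrightarrow> \<bar>sm_integral \<mu> f\<bar> \<le> K * c"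
    using sm_integral_bound[of \<mu>] by metis
  have hK: "\<bar>?h A y\<bar> \<le> K" for A y
    using K(2)[of 1 "\<lambda>x. indicator A (x * y)"] by (auto simp: indicator_def)
  have hm: "?h A \<in> borel_measurable borel_Rp" if "A \<in> sets borel_Rp" for A
    using that by (intro measurable_inner_integral sm_measurable_indicator)
  have hi: "sm_integrable \<nu> (?h A)" if "A \<in> sets borel_Rp" for A
    using hm[OF that] hK by (rule sm_integrable_bounded)
  have sl: "(\<lambda>x. indicator A (x * y) :: real) \<in> borel_measurable borel_Rp"
    if "A \<in> sets borel_Rp" "y \<ge> 0" for A y
    using that by (intro measurable_times_slice sm_measurable_indicator)
  have "meas (\<mu> \<star> \<nu>) A = ?F A"
    unfolding mellin_conv_def
  proof (rule meas_Abs_smeasure)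
    fix A :: "nat \<Rightarrow> real set" assume A: "range A \<subseteq> sets borel_Rp" "disjoint_family A"
    have Ai: "A i \<in> sets borel_Rp" for i using A(1) by auto
    have An: "(\<Union>i<n. A i) \<in> sets borel_Rp" for n :: nat using A(1) by auto
    have AU: "(\<Union>i. A i) \<in> sets borel_Rp" using A(1) by auto
    have "(\<lambda>n. sm_integral \<nu> (\<lambda>y. ?h (\<Union>i<n. A i) y)) \<longlonglongrightarrow> sm_integral \<nu> (?h (\<Union>i. A i))"
    proof (rule sm_integral_dominated_convergence[where w = "\<lambda>_. K"])
      show "sm_integrable \<nu> (\<lambda>_. K)" by (rule sm_integrable_bounded[of _ "\<bar>K\<bar>"]) auto
      fix y :: real assume y: "y \<ge> 0"
      show "(\<lambda>n. ?h (\<Union>i<n. A i) y) \<longlonglongrightarrow> ?h (\<Union>i. A i) y"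
      proof (rule sm_integral_dominated_convergence[where w = "\<lambda>_. 1"])
        show "sm_integrable \<mu> (\<lambda>_. 1)" by (rule sm_integrable_bounded[of _ 1]) auto
        show "(\<lambda>n. indicator (\<Union>i<n. A i) (x * y) :: real) \<longlonglongrightarrow> indicator (\<Union>i. A i) (x * y)" for x
          by (rule LIMSEQ_indicator_UN)
        show "(\<lambda>x. indicator (\<Union>i<n. A i) (x * y) :: real) \<in> borel_measurable borel_Rp"
          "(\<lambda>x. indicator (\<Union>i. A i) (x * y) :: real) \<in> borel_measurable borel_Rp" for n
          using sl[OF An y] sl[OF AU y] .
      qed (auto simp: indicator_def)
    qed (use hm An AU hK in auto)
    also have "(\<lambda>n. sm_integral \<nu> (\<lambda>y. ?h (\<Union>i<n. A i) y)) = (\<lambda>n. \<Sum>i<n. sm_integral \<nu> (?h (A i)))"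
    proof
      fix n
      have "?h (\<Union>i<n. A i) y = (\<Sum>i<n. ?h (A i) y)" if y: "y \<ge> 0" for y
      proof -
        have "?h (\<Union>i<n. A i) y = sm_integral \<mu> (\<lambda>x. \<Sum>i<n. indicator (A i) (x * y))"
          by (simp add: sum_indicator_disjoint[OF A(2)])
        also have "\<dots> = (\<Sum>i<n. ?h (A i) y)"
          by (intro sm_integral_sum sm_integrable_bounded[of _ 1] sl Ai y)
            (auto simp: indicator_def)
        finally show ?thesis .
      qed
      then have "sm_integral \<nu> (?h (\<Union>i<n. A i)) = sm_integral \<nu> (\<lambda>y. \<Sum>i<n. ?h (A i) y)"
        unfolding sm_integral_def[of \<nu>]
        by (intro arg_cong2[where f = minus] Bochner_Integration.integral_cong) auto
      also have "\<dots> = (\<Sum>i<n. sm_integral \<nu> (?h (A i)))"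
        by (intro sm_integral_sum hi Ai) auto
      finally show "sm_integral \<nu> (\<lambda>y. ?h (\<Union>i<n. A i) y) = (\<Sum>i<n. sm_integral \<nu> (?h (A i)))" .
    qed
    finally show "(\<lambda>i. ?F (A i)) sums ?F (\<Union>i. A i)"
      using Ai AU by (simp add: sums_def)
  qed auto
  then show ?thesis using A by simp
qed

lemma sm_integral_mellin_conv:
  assumes f: "f \<in> borel_measurable borel_Rp" and K: "\<And>x. x \<ge> 0 \<Longrightarrow> \<bar>f x\<bar> \<le> K"
  shows "sm_integral (\<mu> \<star> \<nu>) f = sm_integral \<nu> (\<lambda>y. sm_integral \<mu> (\<lambda>x. f (x * y)))"
proof -
  define D where "D M N = distr (N \<Otimes>\<^sub>M M) borel_Rp (\<lambda>(y, x). x * y)" for M N :: "real measure"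
  have D: "finite_measure (D M N)" "sets (D M N) = sets borel_Rp"
    "integral\<^sup>L (D M N) g = (\<integral>y. \<integral>x. g (x * y) \<partial>M \<partial>N)"
    "integrable (D M N) g" "integrable N (\<lambda>y. \<integral>x. g (x * y) \<partial>M)"
    if MN: "finite_measure M" "finite_measure N" "sets M = sets borel_Rp" "sets N = sets borel_Rp"
      and g: "g \<in> borel_measurable borel_Rp" "\<And>x. x \<ge> 0 \<Longrightarrow> \<bar>g x\<bar> \<le> L"
    for M N and g :: "real \<Rightarrow> real" and L
  proof -
    interpret M: finite_measure M by fact
    interpret N: finite_measure N by fact
    interpret P: pair_sigma_finite N M by standard
    interpret NM: finite_measure "N \<Otimes>\<^sub>M M"
      by (intro finite_measure_pair_measure MN)
    have S: "sets (N \<Otimes>\<^sub>M M) = sets (borel_Rp \<Otimes>\<^sub>M borel_Rp)"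
      using MN by (intro sets_pair_measure_cong)
    have m: "(\<lambda>(y, x). x * y) \<in> N \<Otimes>\<^sub>M M \<rightarrow>\<^sub>M borel_Rp"
      using measurable_times_Rp measurable_cong_sets[OF S refl] by blast
    show fin: "finite_measure (D M N)" unfolding D_def using m by (rule NM.finite_measure_distr)
    show s: "sets (D M N) = sets borel_Rp" by (simp add: D_def)
    show int: "integrable (D M N) g"
      using fin s g by (rule finite_measure_integrable_bounded)
    then have i: "integrable (N \<Otimes>\<^sub>M M) (\<lambda>(y, x). g (x * y))"
      using m g(1) unfolding D_def by (subst (asm) integrable_distr_eq) (auto simp: split_beta')
    show "integrable N (\<lambda>y. \<integral>x. g (x * y) \<partial>M)"
      using P.integrable_fst'[OF i] by simp
    have "integral\<^sup>L (D M N) g = (\<integral>p. (case p of (y, x) \<Rightarrow> g (x * y)) \<partial>(N \<Otimes>\<^sub>M M))"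
      using m g(1) unfolding D_def by (subst integral_distr) (auto simp: split_beta')
    also have "\<dots> = (\<integral>y. \<integral>x. g (x * y) \<partial>M \<partial>N)"
      using P.integral_fst'[OF i] by simp
    finally show "integral\<^sup>L (D M N) g = (\<integral>y. \<integral>x. g (x * y) \<partial>M \<partial>N)" .
  qed
  note fin = finite_measure_pos_part finite_measure_neg_part sets_pos_part sets_neg_part
  let ?P = "pos_part \<mu>" and ?N = "neg_part \<mu>" and ?P' = "pos_part \<nu>" and ?N' = "neg_part \<nu>"
  have iter: "sm_integral \<nu> (\<lambda>y. sm_integral \<mu> (\<lambda>x. g (x * y))) =
      integral\<^sup>L (D ?P ?P') g - integral\<^sup>L (D ?N ?P') g - integral\<^sup>L (D ?P ?N') g + integral\<^sup>L (D ?N ?N') g"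
    if g: "g \<in> borel_measurable borel_Rp" "\<And>x. x \<ge> 0 \<Longrightarrow> \<bar>g x\<bar> \<le> L" for g :: "real \<Rightarrow> real" and L
  proof -
    note D' = D(3,5)[OF _ _ _ _ g]
    show ?thesis
      unfolding sm_integral_def
      by (simp add: D' fin Bochner_Integration.integral_diff)
  qed
  have "integral\<^sup>L (pos_part (\<mu> \<star> \<nu>)) f + integral\<^sup>L (D ?N ?P') f + integral\<^sup>L (D ?P ?N') f =
        integral\<^sup>L (neg_part (\<mu> \<star> \<nu>)) f + integral\<^sup>L (D ?P ?P') f + integral\<^sup>L (D ?N ?N') f"
  proof (rule integral_add3_eq[where L = borel_Rp])
    fix A assume A: "A \<in> sets borel_Rp"
    have i: "measure M A = integral\<^sup>L M (indicator A :: real \<Rightarrow> real)" if "sets M = sets borel_Rp" for M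
    proof -
      have "space M = {0..}" using sets_eq_imp_space_eq[OF that] by (simp add: space_restrict_space)
      moreover have "A \<subseteq> {0..}" using sets.sets_into_space[OF A] by (simp add: space_restrict_space)
      ultimately show ?thesis by (simp add: Int_absorb2)
    qed
    have "meas (\<mu> \<star> \<nu>) A =
      measure (D ?P ?P') A - measure (D ?N ?P') A - measure (D ?P ?N') A + measure (D ?N ?N') A"
      unfolding meas_mellin_conv[OF A]
      by (subst iter[of _ 1]) (use A in \<open>auto simp: indicator_def i D_def\<close>)
    then show "measure (pos_part (\<mu> \<star> \<nu>)) A + measure (D ?N ?P') A + measure (D ?P ?N') A =
      measure (neg_part (\<mu> \<star> \<nu>)) A + measure (D ?P ?P') A + measure (D ?N ?N') A"
      using meas_eq_pos_minus_neg[of "\<mu> \<star> \<nu>" A] by simp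
  qed (use D(1,2,4)[OF _ _ _ _ f K] sm_integrable_bounded[OF f K, of "\<mu> \<star> \<nu>"] fin
        in \<open>simp_all add: sm_integrable_def\<close>)
  then show ?thesis
    using iter[OF f K] sm_integral_def[of "\<mu> \<star> \<nu>" f] by simp
qed


section \<open>The fragmentation equation\<close>

definition sm_nonneg :: "smeasure \<Rightarrow> bool"
  where "sm_nonneg \<mu> \<longleftrightarrow> (\<forall>A. meas \<mu> A \<ge> 0)"

text \<open>The complement of the largest relatively open set all of whose measurable subsets are null.\<close>

definition sm_support :: "smeasure \<Rightarrow> real set"
  where "sm_support \<mu> = {x \<in> {0..}. \<forall>U. open U \<longrightarrow> x \<in> U \<longrightarrow>
           (\<exists>A\<in>sets borel_Rp. A \<subseteq> U \<and> meas \<mu> A \<noteq> 0)}"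

text \<open>Finiteness of the total mass is automatic for an \<^typ>\<open>smeasure\<close>.\<close>

definition frag_kernel :: "smeasure \<Rightarrow> bool"
  where "frag_kernel \<kappa> \<longleftrightarrow> sm_nonneg \<kappa> \<and> meas \<kappa> {0} = 0 \<and> meas \<kappa> {1} = 0 \<and>
           sm_support \<kappa> \<subseteq> {0..1} \<and> sm_integral \<kappa> (\<lambda>z. indicator {0..1} z * z) = 1"

definition frag_dual :: "real \<Rightarrow> real \<Rightarrow> smeasure \<Rightarrow> (real \<Rightarrow> real) \<Rightarrow> real \<Rightarrow> real"
  where "frag_dual \<alpha> \<gamma> \<kappa> \<phi> x =
           \<alpha> * x powr \<gamma> * (- \<phi> x + sm_integral \<kappa> (\<lambda>z. indicator {0..1} z * \<phi> (x * z)))"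

text \<open>
  Measure-valued solutions with initial datum \<open>\<mu>0\<close>. The integrability conditions say that the
  integrals in the weak formulation exist; otherwise they would take the default value \<open>0\<close>.
  The value of the family at negative times is irrelevant.
\<close>

definition measure_solution ::
    "real \<Rightarrow> real \<Rightarrow> smeasure \<Rightarrow> smeasure \<Rightarrow> (real \<Rightarrow> smeasure) \<Rightarrow> bool"
  where "measure_solution \<alpha> \<gamma> \<kappa> \<mu>0 \<mu> \<longleftrightarrow>
    \<mu> 0 = \<mu>0 \<and>
    (\<forall>\<phi>. continuous_on {0..} \<phi> \<longrightarrow> bounded (\<phi> ` {0..}) \<longrightarrow>
       continuous_on {0..} (\<lambda>t. sm_integral (\<mu> t) \<phi>)) \<and>
    (\<forall>\<phi>. continuous_on {0..} \<phi> \<longrightarrow> bounded ((\<lambda>x. \<phi> x / (1 + x)) ` {0..}) \<longrightarrow>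
       (\<forall>t\<ge>0. sm_integrable (\<mu> t) \<phi> \<and>
          sm_integrable (\<mu> t) (frag_dual \<alpha> \<gamma> \<kappa> \<phi>) \<and>
          set_integrable lborel {0..t} (\<lambda>s. sm_integral (\<mu> s) (frag_dual \<alpha> \<gamma> \<kappa> \<phi>)) \<and>
          sm_integral (\<mu> t) \<phi> = sm_integral \<mu>0 \<phi> +
            (LINT s:{0..t}|lborel. sm_integral (\<mu> s) (frag_dual \<alpha> \<gamma> \<kappa> \<phi>))))"

text \<open>
  The class in which the solution is unique: non-negative and continuous in time for the total
  variation norm.
\<close>

definition fundamental_solution ::
    "real \<Rightarrow> real \<Rightarrow> smeasure \<Rightarrow> (real \<Rightarrow> smeasure) \<Rightarrow> bool"
  where "fundamental_solution \<alpha> \<gamma> \<kappa> \<mu> \<longleftrightarrow> measure_solution \<alpha> \<gamma> \<kappa> (dirac 1) \<mu> \<and>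
           (\<forall>t\<ge>0. sm_nonneg (\<mu> t)) \<and> continuous_on {0..} \<mu>"

definition kappa_est :: "real \<Rightarrow> (real \<Rightarrow> smeasure) \<Rightarrow> real \<Rightarrow> smeasure"
  where "kappa_est \<alpha> \<mu> t = (1 / (\<alpha> * t)) *\<^sub>R (\<mu> t - exp (- \<alpha> * t) *\<^sub>R dirac 1)"

primrec frag_coeff :: "real \<Rightarrow> smeasure \<Rightarrow> nat \<Rightarrow> smeasure"
  where
    "frag_coeff \<gamma> \<kappa> 0 = 0"
  | "frag_coeff \<gamma> \<kappa> (Suc n) = (1 / real (n + 1)) *\<^sub>R
       (- weight (\<lambda>x. x powr \<gamma>) (frag_coeff \<gamma> \<kappa> n)
        + \<kappa> \<star> weight (\<lambda>y. y powr \<gamma>) (frag_coeff \<gamma> \<kappa> n)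
        + ((- 1) ^ n / fact n) *\<^sub>R \<kappa>)"

end

theory Submission
  imports Defs
begin

text \<open>
  The proof works on the dual side, with test functions. The kernel lives on \<open>[0, 1]\<close> and
  fragmentation only shrinks sizes, so the solution issued from a unit mass at \<open>1\<close> never charges
  \<open>(1, \<infinity>)\<close> (\<open>fundamental_solution_null\<close>). On \<open>[0, 1]\<close> the rate \<open>x\<^sup>\<gamma>\<close> is at most \<open>1\<close>, hence the
  dual generator \<open>G \<phi> x = x\<^sup>\<gamma> (\<integral> \<phi> (x z) d\<kappa>(z) - \<phi> x)\<close> is bounded, with norm at most
  \<open>1 + \<parallel>\<kappa>\<parallel>\<close>.

  The weak equation reads \<open>\<langle>\<mu>\<^sub>t, \<phi>\<rangle> = \<phi> 1 + \<alpha> \<integral>\<^sub>0\<^sup>t \<langle>\<mu>\<^sub>s, G \<phi>\<rangle> ds\<close>. Substituting it into itself \<open>n\<close>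
  times gives a Taylor sum and an iterated integral of size \<open>O((\<alpha> (1 + \<parallel>\<kappa>\<parallel>) t)\<^sup>n / n!)\<close>
  (\<open>fundamental_solution_remainder\<close>), so that
  \<open>\<langle>\<mu>\<^sub>t, \<phi>\<rangle> = \<Sum>k. (\<alpha> t)\<^sup>k / k! \<cdot> (G\<^sup>k \<phi>) 1\<close>. The right-hand side
  involves only \<open>\<alpha>\<close>, \<open>\<gamma>\<close> and \<open>\<kappa>\<close>, so it determines the solution.

  The recursion for \<open>a\<^sub>k\<close> is the transposed form of \<open>G\<^sup>k\<^sup>+\<^sup>1 \<phi> = G\<^sup>k (G \<phi>)\<close>:
  \<open>\<langle>a\<^sub>k, \<phi>\<rangle> = ((G\<^sup>k \<phi>) 1 - (-1)\<^sup>k \<phi> 1) / k!\<close> (\<open>sm_integral_frag_coeff\<close>), the subtracted term being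
  the \<open>k\<close>-th Taylor coefficient of the unfragmented part \<open>e\<^sup>-\<^sup>\<alpha>\<^sup>t \<delta>\<^sub>1\<close>. Therefore
  \<open>\<mu>\<^sub>t - e\<^sup>-\<^sup>\<alpha>\<^sup>t \<delta>\<^sub>1 = \<Sum>k. (\<alpha> t)\<^sup>k a\<^sub>k\<close> when tested against each \<open>\<phi>\<close>, with \<open>a\<^sub>0 = 0\<close> and
  \<open>a\<^sub>1 = \<kappa>\<close>. Dividing by \<open>\<alpha> t\<close> and removing the leading term \<open>\<kappa>\<close> leaves a
  measure of norm at most \<open>\<alpha> t\<close> times the series in the claim. The same identity bounds \<open>\<parallel>a\<^sub>k\<parallel>\<close> by \<open>2 (1 + \<parallel>\<kappa>\<parallel>)\<^sup>k / k!\<close>, so the series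
  converges; its terms increase with \<open>t\<close>, so its maximum over \<open>[0, T]\<close> is attained at \<open>T\<close>.
\<close>

section \<open>Sets on which a signed measure vanishes\<close>

definition sm_null_on :: "real set \<Rightarrow> smeasure \<Rightarrow> bool"
  where "sm_null_on U \<mu> \<longleftrightarrow> (\<forall>A\<in>sets borel_Rp. A \<subseteq> U \<longrightarrow> meas \<mu> A = 0)"

lemma borel_Rp_Int: "U \<in> sets borel \<Longrightarrow> {0..} \<inter> U \<in> sets borel_Rp"
  by (auto simp: sets_restrict_space)

lemma sets_borel_Rp_nonneg: "A \<in> sets borel_Rp \<Longrightarrow> A \<subseteq> {0..}"
  using sets.sets_into_space[of A borel_Rp] by (simp add: space_restrict_space)

lemma sm_null_on_uminus: "sm_null_on U (- \<mu>) \<longleftrightarrow> sm_null_on U \<mu>"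
  by (simp add: sm_null_on_def)

lemma sm_null_on_imp_AE_pos_part:
  assumes "sm_null_on U \<mu>" "U \<in> sets borel"
  shows "AE x in pos_part \<mu>. x \<notin> U"
proof (rule AE_I[where N = "{0..} \<inter> U"])
  show "{x \<in> space (pos_part \<mu>). \<not> x \<notin> U} \<subseteq> {0..} \<inter> U" by auto
  show N: "{0..} \<inter> U \<in> sets (pos_part \<mu>)" using borel_Rp_Int[OF assms(2)] by simp
  have "meas \<mu> B = 0" if "B \<in> sets borel_Rp" "B \<subseteq> {0..} \<inter> U" for B
    using assms(1) that by (auto simp: sm_null_on_def)
  then show "emeasure (pos_part \<mu>) ({0..} \<inter> U) = 0"
    using N by (subst emeasure_pos_part) (auto intro!: antisym[OF SUP_least])
qed

text \<open>
  Transfers nullity to the Jordan parts, where the almost-everywhere calculus of ordinary measures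
  is available.
\<close>

lemma sm_null_on_iff_AE:
  assumes "U \<in> sets borel"
  shows "sm_null_on U \<mu> \<longleftrightarrow> (AE x in pos_part \<mu>. x \<notin> U) \<and> (AE x in neg_part \<mu>. x \<notin> U)"
proof (intro iffI conjI)
  assume "sm_null_on U \<mu>"
  then show "AE x in pos_part \<mu>. x \<notin> U" "AE x in neg_part \<mu>. x \<notin> U"
    unfolding neg_part_def using assms
    by (auto intro!: sm_null_on_imp_AE_pos_part simp: sm_null_on_uminus)
next
  assume AE: "(AE x in pos_part \<mu>. x \<notin> U) \<and> (AE x in neg_part \<mu>. x \<notin> U)"
  show "sm_null_on U \<mu>"
    unfolding sm_null_on_def
  proof (intro ballI impI)
    fix A assume A: "A \<in> sets borel_Rp" "A \<subseteq> U"
    have "measure M A = 0" if "sets M = sets borel_Rp" "AE x in M. x \<notin> U" for M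
    proof -
      have "AE x in M. x \<notin> A" using that(2) A(2) by auto
      then have "emeasure M A = 0"
        using A(1) that(1) by (subst (asm) AE_iff_measurable[of A])
          (auto dest: sets.sets_into_space)
      then show ?thesis by (simp add: measure_def)
    qed
    then show "meas \<mu> A = 0" using AE by (simp add: meas_eq_pos_minus_neg)
  qed
qed

lemma sm_null_on_UN_countable:
  assumes "countable I" "\<And>i. i \<in> I \<Longrightarrow> U i \<in> sets borel" "\<And>i. i \<in> I \<Longrightarrow> sm_null_on (U i) \<mu>"
  shows "sm_null_on (\<Union>i\<in>I. U i) \<mu>"
proof -
  have "(\<Union>i\<in>I. U i) \<in> sets borel" using assms by (intro sets.countable_UN') auto
  moreover have "AE x in pos_part \<mu>. \<forall>i\<in>I. x \<notin> U i" "AE x in neg_part \<mu>. \<forall>i\<in>I. x \<notin> U i"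
    using assms by (auto simp: AE_ball_countable sm_null_on_iff_AE)
  ultimately show ?thesis by (simp add: sm_null_on_iff_AE)
qed

lemma sm_null_on_mono: "sm_null_on U \<mu> \<Longrightarrow> V \<inter> {0..} \<subseteq> U \<Longrightarrow> sm_null_on V \<mu>"
  unfolding sm_null_on_def using sets_borel_Rp_nonneg by blast

text \<open>
  Every point outside the support has a null neighbourhood; by the Lindelof property countably
  many of these neighbourhoods suffice.
\<close>

lemma sm_null_on_complement_support: "sm_null_on (- sm_support \<mu>) \<mu>"
proof -
  define F where "F = {U. open U \<and> sm_null_on U \<mu>}"
  obtain F' where F': "F' \<subseteq> F" "countable F'" "\<Union>F' = \<Union>F"
    using Lindelof[of F] by (auto simp: F_def)
  have "sm_null_on (\<Union>U\<in>F'. U) \<mu>"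
    using F' by (intro sm_null_on_UN_countable) (auto simp: F_def)
  moreover have "- sm_support \<mu> \<inter> {0..} \<subseteq> \<Union>F"
  proof
    fix x assume x: "x \<in> - sm_support \<mu> \<inter> {0..}"
    then obtain U where "open U" "x \<in> U" "\<forall>A\<in>sets borel_Rp. A \<subseteq> U \<longrightarrow> meas \<mu> A = 0"
      by (auto simp: sm_support_def)
    then show "x \<in> \<Union>F" by (auto simp: F_def sm_null_on_def)
  qed
  ultimately show ?thesis using F'(3) by (auto intro: sm_null_on_mono)
qed

lemma sm_integrable_imp_measurable:
  "sm_integrable \<mu> f \<Longrightarrow> f \<in> borel_measurable borel_Rp"
  using measurable_cong_sets[OF sets_pos_part refl]
  by (auto simp: sm_integrable_def dest: borel_measurable_integrable)

lemma sm_integral_cong_null: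
  assumes "sm_null_on U \<mu>" "U \<in> sets borel"
    and "f \<in> borel_measurable borel_Rp" "g \<in> borel_measurable borel_Rp"
    and "\<And>x. x \<ge> 0 \<Longrightarrow> x \<notin> U \<Longrightarrow> f x = g x"
  shows "sm_integral \<mu> f = sm_integral \<mu> g"
proof -
  have "integral\<^sup>L M f = integral\<^sup>L M g"
    if M: "sets M = sets borel_Rp" "AE x in M. x \<notin> U" for M
  proof (rule integral_cong_AE)
    have sp: "space M = {0..}" using sets_eq_imp_space_eq[OF M(1)] by (simp add: space_restrict_space)
    show "AE x in M. f x = g x" using M(2) AE_space by eventually_elim (use assms(5) sp in auto)
  qed (use assms(3,4) measurable_cong_sets[OF M(1) refl] in auto)
  then show ?thesis using assms(1,2) by (simp add: sm_integral_def sm_null_on_iff_AE)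
qed

lemma sm_integral_cong:
  assumes "\<And>x. x \<ge> 0 \<Longrightarrow> f x = g x"
  shows "sm_integral \<mu> f = sm_integral \<mu> g"
  unfolding sm_integral_def using assms
  by (intro arg_cong2[where f = minus] Bochner_Integration.integral_cong) auto

lemma sm_integrable_bounded_null:
  assumes "sm_null_on U \<mu>" "U \<in> sets borel" "f \<in> borel_measurable borel_Rp"
    and "\<And>x. x \<ge> 0 \<Longrightarrow> x \<notin> U \<Longrightarrow> \<bar>f x\<bar> \<le> K"
  shows "sm_integrable \<mu> f"
proof -
  have "integrable M f"
    if M: "finite_measure M" "sets M = sets borel_Rp" "AE x in M. x \<notin> U" for M
  proof (rule finite_measure.integrable_const_bound[OF M(1), of _ K])
    have sp: "space M = {0..}" using sets_eq_imp_space_eq[OF M(2)] by (simp add: space_restrict_space)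
    show "AE x in M. norm (f x) \<le> K" using M(3) AE_space by eventually_elim (use assms(4) sp in auto)
  qed (use assms(3) measurable_cong_sets[OF M(2) refl] in auto)
  then show ?thesis using assms(1,2)
    by (simp add: sm_integrable_def sm_null_on_iff_AE finite_measure_pos_part finite_measure_neg_part)
qed


section \<open>Integrals in signed measures\<close>

lemma sm_integral_cmult: "sm_integral \<mu> (\<lambda>x. c * f x) = c * sm_integral \<mu> f"
  by (simp add: sm_integral_def right_diff_distrib)

lemma sm_integral_diff:
  "sm_integrable \<mu> f \<Longrightarrow> sm_integrable \<mu> g \<Longrightarrow>
     sm_integral \<mu> (\<lambda>x. f x - g x) = sm_integral \<mu> f - sm_integral \<mu> g"
  by (simp add: sm_integral_def sm_integrable_def)

lemma sm_integral_minus_measure: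
  assumes "sm_integrable \<mu> f" "sm_integrable \<nu> f" "sm_integrable (\<mu> - \<nu>) f"
  shows "sm_integral (\<mu> - \<nu>) f = sm_integral \<mu> f - sm_integral \<nu> f"
  using sm_integral_plus_measure[of \<mu> f "- \<nu>"] assms
  by (simp add: sm_integral_uminus_measure sm_integrable_uminus_measure)

lemma sm_integral_zero_measure: "sm_integral 0 f = 0"
  using sm_integral_scaleR_measure[of 0 0 f] by simp

lemma sm_integral_dirac:
  assumes "f \<in> borel_measurable borel_Rp" "a \<ge> 0"
  shows "sm_integral (dirac a) f = f a"
proof -
  have a: "{a} \<in> sets borel_Rp" using borel_Rp_Int[of "{a}"] assms(2) by simp
  have "sm_null_on (- {a}) (dirac a)"
    unfolding sm_null_on_def by transfer auto
  then have "sm_integral (dirac a) f = sm_integral (dirac a) (\<lambda>x. f a * indicator {a} x)"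
    using assms a by (intro sm_integral_cong_null[where U = "- {a}"]) auto
  also have "\<dots> = f a * meas (dirac a) {a}"
    using a by (simp add: sm_integral_cmult sm_integral_indicator)
  also have "meas (dirac a) {a} = 1" using a by transfer simp
  finally show ?thesis by simp
qed

text \<open>
  For \<open>f \<ge> 0\<close> the densities of the two Jordan parts are finite positive measures whose difference is
  the weighted measure. They need not be its Jordan parts, so the integrals are compared through an
  equality of sums of positive measures; the null measure fills the third place of
  \<open>integral_add3_eq\<close>.
\<close>

lemma sm_integral_weight:
  assumes f: "sm_integrable \<mu> f" "\<And>x. x \<ge> 0 \<Longrightarrow> f x \<ge> 0"
    and g: "g \<in> borel_measurable borel_Rp" "\<And>x. x \<ge> 0 \<Longrightarrow> \<bar>g x\<bar> \<le> K"
  shows "sm_integral (weight f \<mu>) g = sm_integral \<mu> (\<lambda>x. f x * g x)"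
proof -
  let ?P = "density (pos_part \<mu>) (\<lambda>x. ennreal (f x))" and ?N = "density (neg_part \<mu>) (\<lambda>x. ennreal (f x))"
    and ?Z = "null_measure borel_Rp"
  have fm: "f \<in> borel_measurable borel_Rp" using f(1) by (rule sm_integrable_imp_measurable)
  have D: "finite_measure (density M (\<lambda>x. ennreal (f x)))"
      "measure (density M (\<lambda>x. ennreal (f x))) A = integral\<^sup>L M (\<lambda>x. indicator A x * f x)"
      "integral\<^sup>L (density M (\<lambda>x. ennreal (f x))) g = integral\<^sup>L M (\<lambda>x. f x * g x)"
    if M: "sets M = sets borel_Rp" "integrable M f" and A: "A \<in> sets borel_Rp" for M A
  proof -
    have sp: "space M = {0..}" using sets_eq_imp_space_eq[OF M(1)] by (simp add: space_restrict_space)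
    have nn: "AE x in M. 0 \<le> f x" using f(2) sp by (intro AE_I2) auto
    have fM: "f \<in> borel_measurable M" and gM: "g \<in> borel_measurable M"
      using fm g(1) measurable_cong_sets[OF M(1) refl] by auto
    have em: "emeasure (density M (\<lambda>x. ennreal (f x))) A = ennreal (integral\<^sup>L M (\<lambda>x. indicator A x * f x))"
      if "A \<in> sets borel_Rp" for A
    proof -
      have i: "integrable M (\<lambda>x. indicator A x * f x)"
        using integrable_real_mult_indicator[of A M f] M that by (simp add: mult.commute)
      have "emeasure (density M (\<lambda>x. ennreal (f x))) A = (\<integral>\<^sup>+x. ennreal (indicator A x * f x) \<partial>M)"
        using fM that M(1) by (subst emeasure_density)
          (auto intro!: nn_integral_cong simp: indicator_def)
      also have "\<dots> = ennreal (integral\<^sup>L M (\<lambda>x. indicator A x * f x))"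
        using i f(2) sp by (intro nn_integral_eq_integral AE_I2) (auto simp: indicator_def)
      finally show ?thesis .
    qed
    show "finite_measure (density M (\<lambda>x. ennreal (f x)))"
    proof (rule finite_measureI)
      have "space M \<in> sets borel_Rp" using sets.top[of M] M(1) by simp
      then show "emeasure (density M (\<lambda>x. ennreal (f x))) (space (density M (\<lambda>x. ennreal (f x)))) \<noteq> \<infinity>"
        using em by simp
    qed
    have "0 \<le> integral\<^sup>L M (\<lambda>x. indicator A x * f x)"
      using f(2) sp by (intro integral_nonneg_AE AE_I2) (auto simp: indicator_def)
    then show "measure (density M (\<lambda>x. ennreal (f x))) A = integral\<^sup>L M (\<lambda>x. indicator A x * f x)"
      unfolding measure_def em[OF A] by simp
    show "integral\<^sup>L (density M (\<lambda>x. ennreal (f x))) g = integral\<^sup>L M (\<lambda>x. f x * g x)"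
      using gM fM nn by (subst integral_density) auto
  qed
  note int = f(1)[unfolded sm_integrable_def]
  note D' = D[OF sets_pos_part int[THEN conjunct1]] D[OF sets_neg_part int[THEN conjunct2]]
  have E: "{} \<in> sets borel_Rp" by simp
  have fin: "finite_measure ?P" "finite_measure ?N" "finite_measure ?Z"
    using D'(1,4)[OF E] by (auto intro: finite_measureI)
  have "integral\<^sup>L (pos_part (weight f \<mu>)) g + integral\<^sup>L ?N g + integral\<^sup>L ?Z g =
        integral\<^sup>L (neg_part (weight f \<mu>)) g + integral\<^sup>L ?P g + integral\<^sup>L ?Z g"
  proof (rule integral_add3_eq[where L = borel_Rp])
    fix A assume A: "A \<in> sets borel_Rp"
    have "measure (pos_part (weight f \<mu>)) A - measure (neg_part (weight f \<mu>)) A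
        = measure ?P A - measure ?N A"
      using meas_weight[OF f(1) A] meas_eq_pos_minus_neg[of "weight f \<mu>" A] D'(2,5)[OF A]
      by (simp add: sm_integral_def)
    then show "measure (pos_part (weight f \<mu>)) A + measure ?N A + measure ?Z A =
        measure (neg_part (weight f \<mu>)) A + measure ?P A + measure ?Z A" by simp
  qed (use fin finite_measure_pos_part finite_measure_neg_part
        finite_measure_integrable_bounded[OF _ _ g] in auto)
  then show ?thesis using D'(3,6)[OF E] by (simp add: sm_integral_def)
qed

lemma sm_nonneg_AE_neg_part:
  assumes "sm_nonneg \<mu>"
  shows "AE x in neg_part \<mu>. False"
proof -
  have "emeasure (neg_part \<mu>) {0..} = 0"
  proof -
    have "(SUP B\<in>{B \<in> sets borel_Rp. B \<subseteq> {0..}}. ennreal (meas (- \<mu>) B)) \<le> 0"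
      using assms by (intro SUP_least) (simp add: sm_nonneg_def ennreal_neg)
    then show ?thesis
      unfolding neg_part_def using borel_Rp_Int[of UNIV] by (simp add: emeasure_pos_part)
  qed
  then show ?thesis
    using borel_Rp_Int[of UNIV] by (intro AE_I[where N = "{0..}"]) auto
qed

lemma sm_integral_nonneg_measure:
  assumes "sm_nonneg \<mu>"
  shows "sm_integral \<mu> f = integral\<^sup>L (pos_part \<mu>) f"
proof -
  have "AE x in neg_part \<mu>. f x = 0"
    using sm_nonneg_AE_neg_part[OF assms] by eventually_elim simp
  then have "integral\<^sup>L (neg_part \<mu>) f = 0" by (rule integral_eq_zero_AE)
  then show ?thesis by (simp add: sm_integral_def)
qed

lemma sm_integral_nonneg:
  assumes "sm_nonneg \<mu>" "\<And>x. x \<ge> 0 \<Longrightarrow> f x \<ge> 0"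
  shows "sm_integral \<mu> f \<ge> 0"
  unfolding sm_integral_nonneg_measure[OF assms(1)]
  by (rule integral_nonneg_AE, rule AE_I2) (use assms(2) in simp)

lemma sm_integral_mono:
  assumes "sm_nonneg \<mu>" "sm_integrable \<mu> f" "sm_integrable \<mu> g" "\<And>x. x \<ge> 0 \<Longrightarrow> f x \<le> g x"
  shows "sm_integral \<mu> f \<le> sm_integral \<mu> g"
  unfolding sm_integral_nonneg_measure[OF assms(1)]
  by (rule integral_mono) (use assms(2-4) in \<open>simp_all add: sm_integrable_def\<close>)

lemma sm_null_on_weight:
  assumes "sm_null_on U \<mu>" "U \<in> sets borel" "sm_integrable \<mu> f"
  shows "sm_null_on U (weight f \<mu>)"
  unfolding sm_null_on_def
proof (intro ballI impI)
  fix A assume A: "A \<in> sets borel_Rp" "A \<subseteq> U"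
  have "sm_integral \<mu> (\<lambda>x. indicator A x * f x) = sm_integral \<mu> (\<lambda>x. 0)"
    using assms A sm_integrable_imp_measurable[OF assms(3)]
    by (intro sm_integral_cong_null[OF assms(1,2)]) (auto simp: indicator_def)
  then show "meas (weight f \<mu>) A = 0" using meas_weight[OF assms(3) A(1)] by (simp add: sm_integral_def)
qed

lemma sm_null_on_mellin_conv:
  assumes "sm_null_on {1<..} \<mu>" "sm_null_on {1<..} \<nu>"
  shows "sm_null_on {1<..} (\<mu> \<star> \<nu>)"
  unfolding sm_null_on_def
proof (intro ballI impI)
  fix A assume A: "A \<in> sets borel_Rp" "A \<subseteq> {1<..}"
  have inner: "sm_integral \<mu> (\<lambda>x. indicator A (x * y)) = 0" if y: "y \<ge> 0" "y \<notin> {1<..}" for y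
  proof -
    have "sm_integral \<mu> (\<lambda>x. indicator A (x * y)) = sm_integral \<mu> (\<lambda>x. 0)"
    proof (rule sm_integral_cong_null[OF assms(1)])
      show "(\<lambda>x. indicator A (x * y) :: real) \<in> borel_measurable borel_Rp"
        using A y by (intro measurable_times_slice sm_measurable_indicator)
      fix x :: real assume "x \<ge> 0" "x \<notin> {1<..}"
      then have "x * y \<le> 1" using y by (intro mult_le_one) auto
      then show "indicator A (x * y) = (0 :: real)" using A(2) by (auto simp: indicator_def)
    qed auto
    then show ?thesis by (simp add: sm_integral_def)
  qed
  have "meas (\<mu> \<star> \<nu>) A = sm_integral \<nu> (\<lambda>y. 0)"
    unfolding meas_mellin_conv[OF A(1)]
    using A(1) inner measurable_inner_integral[OF sm_measurable_indicator[OF A(1)], of \<mu>]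
    by (intro sm_integral_cong_null[OF assms(2)]) auto
  then show "meas (\<mu> \<star> \<nu>) A = 0" by (simp add: sm_integral_def)
qed

lemma sm_null_on_lincomb:
  "sm_null_on U \<mu> \<Longrightarrow> sm_null_on U \<nu> \<Longrightarrow> sm_null_on U (\<mu> + \<nu>)"
  "sm_null_on U \<mu> \<Longrightarrow> sm_null_on U \<nu> \<Longrightarrow> sm_null_on U (\<mu> - \<nu>)"
  "sm_null_on U \<mu> \<Longrightarrow> sm_null_on U (c *\<^sub>R \<mu>)"
  by (auto simp: sm_null_on_def)


section \<open>Test functions and the total variation norm\<close>

definition test_fun :: "real \<Rightarrow> (real \<Rightarrow> real) \<Rightarrow> bool"
  where "test_fun K \<phi> \<longleftrightarrow> continuous_on {0..} \<phi> \<and> (\<forall>x\<ge>0. \<bar>\<phi> x\<bar> \<le> K)"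

lemma test_fun_measurable: "test_fun K \<phi> \<Longrightarrow> \<phi> \<in> borel_measurable borel_Rp"
  by (auto simp: test_fun_def intro: borel_measurable_continuous_on_restrict)

lemma test_fun_sm_integrable: "test_fun K \<phi> \<Longrightarrow> sm_integrable \<mu> \<phi>"
  using sm_integrable_bounded[OF test_fun_measurable] by (auto simp: test_fun_def)

lemma norm_smeasure_test_fun: "norm \<mu> = (SUP \<phi>\<in>Collect (test_fun 1). sm_integral \<mu> \<phi>)"
  using test_fun_sm_integrable[of 1] unfolding norm_smeasure_def test_fun_def
  by (intro arg_cong[where f = Sup]) blast

lemma sm_integral_le_norm:
  assumes "test_fun 1 \<phi>"
  shows "sm_integral \<mu> \<phi> \<le> norm \<mu>"
proof -
  obtain K where K: "\<And>f c. c \<ge> 0 \<Longrightarrow> (\<And>x. x \<ge> 0 \<Longrightarrow> \<bar>f x\<bar> \<le> c) \<Longrightarrow> \<bar>sm_integral \<mu> f\<bar> \<le> K * c"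
    using sm_integral_bound[of \<mu>] by metis
  have "bdd_above (sm_integral \<mu> ` Collect (test_fun 1))"
    using K[of 1] by (intro bdd_aboveI2[where M = K]) (force simp: test_fun_def abs_le_iff)
  then show ?thesis unfolding norm_smeasure_test_fun using assms by (intro cSUP_upper) auto
qed

lemma norm_smeasure_le:
  assumes "\<And>\<phi>. test_fun 1 \<phi> \<Longrightarrow> sm_integral \<mu> \<phi> \<le> K"
  shows "norm \<mu> \<le> K"
proof -
  have "test_fun 1 (\<lambda>_. 0)" by (simp add: test_fun_def)
  then show ?thesis unfolding norm_smeasure_test_fun using assms by (intro cSUP_least) auto
qed

lemma test_fun_nonneg: "test_fun K \<phi> \<Longrightarrow> K \<ge> 0"
  using abs_ge_zero[of "\<phi> 0"] unfolding test_fun_def by (meson order.refl order_trans)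

text \<open>
  This replaces the unspecified constant of \<open>sm_integral_bound\<close> by the norm, for continuous
  functions only. The case \<open>K = 0\<close> is separate because the proof rescales by \<open>1 / K\<close>.
\<close>

lemma abs_sm_integral_le_norm:
  assumes \<phi>: "test_fun K \<phi>"
  shows "\<bar>sm_integral \<mu> \<phi>\<bar> \<le> norm \<mu> * K"
proof (cases "K = 0")
  case True
  then have "sm_integral \<mu> \<phi> = sm_integral \<mu> (\<lambda>_. 0)"
    using \<phi> by (intro sm_integral_cong) (auto simp: test_fun_def)
  then show ?thesis using True by (simp add: sm_integral_def)
next
  case False
  then have K: "K > 0" using test_fun_nonneg[OF \<phi>] by simp
  have test: "test_fun 1 (\<lambda>x. c * \<phi> x)" if "\<bar>c\<bar> = 1 / K" for c
    using \<phi> K by (auto simp: test_fun_def abs_mult that intro!: continuous_intros)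
  show ?thesis
    using sm_integral_le_norm[OF test[of "1 / K"], of \<mu>] sm_integral_le_norm[OF test[of "- (1 / K)"], of \<mu>] K
    unfolding sm_integral_cmult by (auto simp: field_simps abs_le_iff)
qed


section \<open>The dual generator\<close>

text \<open>
  The adjoint of \<open>\<mu> \<mapsto> - x\<^sup>\<gamma> \<mu> + \<kappa> \<star> (x\<^sup>\<gamma> \<mu>)\<close>, made constant for \<open>x \<ge> 1\<close>. Measures null
  on \<open>(1, \<infinity>)\<close> do not see the truncation, while without it \<open>x\<^sup>\<gamma>\<close> would be unbounded and the iterates
  would leave the test functions for which the weak formulation is available.
\<close>

definition frag_gen :: "real \<Rightarrow> smeasure \<Rightarrow> (real \<Rightarrow> real) \<Rightarrow> real \<Rightarrow> real"
  where "frag_gen \<gamma> \<kappa> \<phi> x =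
    min x 1 powr \<gamma> * (sm_integral \<kappa> (\<lambda>z. \<phi> (z * min x 1)) - \<phi> (min x 1))"

lemma test_fun_slice:
  assumes "test_fun K \<phi>" "y \<ge> 0"
  shows "test_fun K (\<lambda>z. \<phi> (z * y))"
proof -
  have "continuous_on {0..} (\<lambda>z. \<phi> (z * y))"
  proof (rule continuous_on_compose2[of "{0..}" \<phi>])
    show "continuous_on {0..} \<phi>" using assms by (simp add: test_fun_def)
  qed (use assms in \<open>auto intro!: continuous_intros\<close>)
  then show ?thesis using assms by (auto simp: test_fun_def)
qed

lemma continuous_on_inner_integral:
  assumes \<phi>: "test_fun K \<phi>"
  shows "continuous_on {0..} (\<lambda>y. sm_integral \<kappa> (\<lambda>z. \<phi> (z * y)))"
proof (rule continuous_on_sequentiallyI)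
  fix u :: "nat \<Rightarrow> real" and a :: real
  assume u: "\<forall>n. u n \<in> {0..}" "a \<in> {0..}" "u \<longlonglongrightarrow> a"
  show "(\<lambda>n. sm_integral \<kappa> (\<lambda>z. \<phi> (z * u n))) \<longlonglongrightarrow> sm_integral \<kappa> (\<lambda>z. \<phi> (z * a))"
  proof (rule sm_integral_dominated_convergence[where w = "\<lambda>_. K"])
    show "sm_integrable \<kappa> (\<lambda>_. K)" by (rule sm_integrable_bounded[of _ "\<bar>K\<bar>"]) auto
    show "(\<lambda>z. \<phi> (z * u n)) \<in> borel_measurable borel_Rp" "(\<lambda>z. \<phi> (z * a)) \<in> borel_measurable borel_Rp" for n
      using u by (auto intro!: test_fun_measurable[OF test_fun_slice[OF \<phi>]])
    fix z :: real assume z: "z \<ge> 0"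
    have "continuous_on {0..} \<phi>" using \<phi> by (simp add: test_fun_def)
    moreover have "(\<lambda>n. z * u n) \<longlonglongrightarrow> z * a" using u by (intro tendsto_intros)
    ultimately show "(\<lambda>n. \<phi> (z * u n)) \<longlonglongrightarrow> \<phi> (z * a)"
      using u z by (intro continuous_on_tendsto_compose[of "{0..}" \<phi>]) auto
    show "\<bar>\<phi> (z * u n)\<bar> \<le> K" for n using \<phi> u z by (auto simp: test_fun_def)
  qed
qed

lemma test_fun_frag_gen:
  assumes \<phi>: "test_fun K \<phi>" and "\<gamma> > 0"
  shows "test_fun ((1 + norm \<kappa>) * K) (frag_gen \<gamma> \<kappa> \<phi>)"
  unfolding test_fun_def
proof (intro conjI allI impI)
  have "continuous_on {0..} \<phi>" using \<phi> by (simp add: test_fun_def)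
  then have "continuous_on {0..} (\<lambda>x. \<phi> (min x 1))"
    by (rule continuous_on_compose2) (auto intro!: continuous_intros)
  moreover have "continuous_on {0..} (\<lambda>x. sm_integral \<kappa> (\<lambda>z. \<phi> (z * min x 1)))"
    by (rule continuous_on_compose2[OF continuous_on_inner_integral[OF \<phi>, of \<kappa>]])
      (auto intro!: continuous_intros)
  moreover have "continuous_on {0..} (\<lambda>x. min x 1 powr \<gamma>)"
    using \<open>\<gamma> > 0\<close> by (intro continuous_on_powr' continuous_intros) auto
  ultimately show "continuous_on {0..} (frag_gen \<gamma> \<kappa> \<phi>)"
    unfolding frag_gen_def by (intro continuous_on_mult continuous_on_diff)
  fix x :: real assume x: "x \<ge> 0"
  have "\<bar>sm_integral \<kappa> (\<lambda>z. \<phi> (z * min x 1))\<bar> \<le> norm \<kappa> * K"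
    using x by (intro abs_sm_integral_le_norm test_fun_slice[OF \<phi>]) auto
  moreover have "\<bar>\<phi> (min x 1)\<bar> \<le> K" using \<phi> x by (simp add: test_fun_def)
  ultimately have "\<bar>sm_integral \<kappa> (\<lambda>z. \<phi> (z * min x 1)) - \<phi> (min x 1)\<bar> \<le> (1 + norm \<kappa>) * K"
    by (simp add: algebra_simps)
  moreover have "min x 1 powr \<gamma> \<le> 1" using x \<open>\<gamma> > 0\<close> by (intro powr_le1) auto
  ultimately have "min x 1 powr \<gamma> * \<bar>sm_integral \<kappa> (\<lambda>z. \<phi> (z * min x 1)) - \<phi> (min x 1)\<bar>
      \<le> 1 * ((1 + norm \<kappa>) * K)"
    by (intro mult_mono) auto
  then show "\<bar>frag_gen \<gamma> \<kappa> \<phi> x\<bar> \<le> (1 + norm \<kappa>) * K" by (simp add: frag_gen_def abs_mult)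
qed

lemma test_fun_frag_gen_iter:
  assumes "test_fun K \<phi>" "\<gamma> > 0"
  shows "test_fun ((1 + norm \<kappa>) ^ k * K) ((frag_gen \<gamma> \<kappa> ^^ k) \<phi>)"
proof (induction k)
  case (Suc k)
  then show ?case using test_fun_frag_gen[OF Suc assms(2), of \<kappa>] by (simp add: mult.assoc)
qed (use assms in simp)

lemma frag_kernel_null:
  assumes "frag_kernel \<kappa>"
  shows "sm_null_on {1<..} \<kappa>"
  by (rule sm_null_on_mono[OF sm_null_on_complement_support])
    (use assms in \<open>auto simp: frag_kernel_def\<close>)

lemma powr_measurable: "(\<lambda>x. x powr \<gamma>) \<in> borel_measurable borel_Rp"
  by (intro measurable_restrict_space1) simp

lemma sm_integrable_powr_mult:
  assumes "sm_null_on {1<..} \<mu>" "\<gamma> > 0" "f \<in> borel_measurable borel_Rp"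
    and "\<And>x. x \<ge> 0 \<Longrightarrow> \<bar>f x\<bar> \<le> K"
  shows "sm_integrable \<mu> (\<lambda>x. x powr \<gamma> * f x)"
proof (rule sm_integrable_bounded_null[OF assms(1), of _ K])
  fix x :: real assume x: "x \<ge> 0" "x \<notin> {1<..}"
  have "x powr \<gamma> * \<bar>f x\<bar> \<le> 1 * K" using x assms(2,4) by (intro mult_mono powr_le1) auto
  then show "\<bar>x powr \<gamma> * f x\<bar> \<le> K" by (simp add: abs_mult)
qed (use assms(3) powr_measurable in auto)

lemma sm_integral_weight_powr:
  assumes "sm_null_on {1<..} \<mu>" "\<gamma> > 0" "g \<in> borel_measurable borel_Rp" "\<And>x. x \<ge> 0 \<Longrightarrow> \<bar>g x\<bar> \<le> K"
  shows "sm_integral (weight (\<lambda>x. x powr \<gamma>) \<mu>) g = sm_integral \<mu> (\<lambda>x. x powr \<gamma> * g x)"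
  using sm_integrable_powr_mult[OF assms(1,2), of "\<lambda>_. 1" 1] assms(3,4)
  by (intro sm_integral_weight) auto

lemma sm_null_on_frag_coeff:
  assumes "sm_null_on {1<..} \<kappa>" "\<gamma> > 0"
  shows "sm_null_on {1<..} (frag_coeff \<gamma> \<kappa> k)"
proof (induction k)
  case (Suc k)
  have "sm_null_on {1<..} (weight (\<lambda>x. x powr \<gamma>) (frag_coeff \<gamma> \<kappa> k))"
    using sm_integrable_powr_mult[OF Suc assms(2), of "\<lambda>_. 1" 1] Suc
    by (intro sm_null_on_weight) auto
  then show ?case
    using assms(1) by (auto intro!: sm_null_on_lincomb sm_null_on_mellin_conv)
qed (simp add: sm_null_on_def)

lemma sm_integral_frag_gen:
  assumes \<phi>: "test_fun K \<phi>" and "sm_null_on {1<..} \<mu>" "\<gamma> > 0"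
  shows "sm_integral \<mu> (frag_gen \<gamma> \<kappa> \<phi>) =
     sm_integral (\<kappa> \<star> weight (\<lambda>y. y powr \<gamma>) \<mu>) \<phi> - sm_integral (weight (\<lambda>x. x powr \<gamma>) \<mu>) \<phi>"
proof -
  define h where "h y = sm_integral \<kappa> (\<lambda>z. \<phi> (z * y))" for y
  have \<phi>b: "\<phi> \<in> borel_measurable borel_Rp" "\<And>x. x \<ge> 0 \<Longrightarrow> \<bar>\<phi> x\<bar> \<le> K"
    using test_fun_measurable[OF \<phi>] \<phi> by (auto simp: test_fun_def)
  have hb: "h \<in> borel_measurable borel_Rp" "\<And>x. x \<ge> 0 \<Longrightarrow> \<bar>h x\<bar> \<le> norm \<kappa> * K"
    using measurable_inner_integral[OF \<phi>b(1)] abs_sm_integral_le_norm[OF test_fun_slice[OF \<phi>]]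
    by (simp_all add: h_def[abs_def])
  have "sm_integral \<mu> (frag_gen \<gamma> \<kappa> \<phi>) = sm_integral \<mu> (\<lambda>x. x powr \<gamma> * h x - x powr \<gamma> * \<phi> x)"
  proof (rule sm_integral_cong_null[OF assms(2)])
    show "frag_gen \<gamma> \<kappa> \<phi> \<in> borel_measurable borel_Rp"
      by (rule test_fun_measurable[OF test_fun_frag_gen[OF \<phi> assms(3)]])
    show "(\<lambda>x. x powr \<gamma> * h x - x powr \<gamma> * \<phi> x) \<in> borel_measurable borel_Rp"
      by (intro borel_measurable_diff borel_measurable_times powr_measurable hb(1) \<phi>b(1))
  qed (auto simp: frag_gen_def h_def algebra_simps)
  also have "\<dots> = sm_integral \<mu> (\<lambda>x. x powr \<gamma> * h x) - sm_integral \<mu> (\<lambda>x. x powr \<gamma> * \<phi> x)"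
    using hb \<phi>b assms(2,3) by (intro sm_integral_diff sm_integrable_powr_mult)
  also have "\<dots> = sm_integral (weight (\<lambda>y. y powr \<gamma>) \<mu>) h - sm_integral (weight (\<lambda>x. x powr \<gamma>) \<mu>) \<phi>"
    using sm_integral_weight_powr[OF assms(2,3) hb] sm_integral_weight_powr[OF assms(2,3) \<phi>b] by simp
  also have "sm_integral (weight (\<lambda>y. y powr \<gamma>) \<mu>) h = sm_integral (\<kappa> \<star> weight (\<lambda>y. y powr \<gamma>) \<mu>) \<phi>"
    unfolding h_def by (rule sm_integral_mellin_conv[OF \<phi>b, symmetric])
  finally show ?thesis .
qed

text \<open>
  Induction over all test functions at once: applying the recursion to \<open>\<phi>\<close> produces
  \<open>\<langle>a\<^sub>k, G \<phi>\<rangle>\<close>, to which the hypothesis for \<open>G \<phi>\<close> applies, and since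
  \<open>(G \<phi>) 1 = \<langle>\<kappa>, \<phi>\<rangle> - \<phi> 1\<close> the source term \<open>(-1)\<^sup>k \<kappa> / k!\<close> cancels exactly the \<open>\<kappa>\<close> contribution of
  \<open>(-1)\<^sup>k (G \<phi>) 1\<close>.
\<close>

lemma sm_integral_frag_coeff:
  assumes "test_fun K \<phi>" and \<kappa>: "sm_null_on {1<..} \<kappa>" "\<gamma> > 0"
  shows "sm_integral (frag_coeff \<gamma> \<kappa> k) \<phi> = ((frag_gen \<gamma> \<kappa> ^^ k) \<phi> 1 - (- 1) ^ k * \<phi> 1) / fact k"
  using assms(1)
proof (induction k arbitrary: K \<phi>)
  case 0
  then show ?case by (simp add: sm_integral_zero_measure)
next
  case (Suc k)
  let ?a = "frag_coeff \<gamma> \<kappa> k" and ?G = "frag_gen \<gamma> \<kappa>"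
  let ?w = "weight (\<lambda>x. x powr \<gamma>) ?a"
  have int: "sm_integrable \<nu> \<phi>" for \<nu> by (rule test_fun_sm_integrable[OF Suc.prems])
  have G1: "?G \<phi> 1 = sm_integral \<kappa> \<phi> - \<phi> 1" by (simp add: frag_gen_def)
  have "sm_integral (frag_coeff \<gamma> \<kappa> (Suc k)) \<phi> =
      (sm_integral (\<kappa> \<star> ?w) \<phi> - sm_integral ?w \<phi> + (- 1) ^ k / fact k * sm_integral \<kappa> \<phi>) / (k + 1)"
    by (simp add: sm_integral_scaleR_measure sm_integral_plus_measure sm_integral_minus_measure int)
  also have "sm_integral (\<kappa> \<star> ?w) \<phi> - sm_integral ?w \<phi> = sm_integral ?a (?G \<phi>)"
    using sm_integral_frag_gen[OF Suc.prems sm_null_on_frag_coeff[OF \<kappa>] \<kappa>(2)] by simp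
  also have "sm_integral ?a (?G \<phi>) = ((?G ^^ Suc k) \<phi> 1 - (- 1) ^ k * ?G \<phi> 1) / fact k"
    using Suc.IH[OF test_fun_frag_gen[OF Suc.prems \<kappa>(2)]] by (simp add: funpow_swap1)
  finally show ?case
    by (simp add: G1 field_simps del: funpow.simps)
qed

lemma norm_frag_coeff_le:
  assumes \<kappa>: "sm_null_on {1<..} \<kappa>" "\<gamma> > 0"
  shows "norm (frag_coeff \<gamma> \<kappa> k) \<le> 2 * (1 + norm \<kappa>) ^ k / fact k"
proof (rule norm_smeasure_le)
  fix \<phi> assume \<phi>: "test_fun 1 \<phi>"
  have "\<bar>(frag_gen \<gamma> \<kappa> ^^ k) \<phi> 1\<bar> \<le> (1 + norm \<kappa>) ^ k"
    using test_fun_frag_gen_iter[OF \<phi> \<kappa>(2), of \<kappa> k] by (simp add: test_fun_def)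
  moreover have "\<bar>(- 1) ^ k * \<phi> 1\<bar> \<le> 1" using \<phi> by (simp add: test_fun_def abs_mult)
  moreover have "1 \<le> (1 + norm \<kappa>) ^ k" by simp
  ultimately have "(frag_gen \<gamma> \<kappa> ^^ k) \<phi> 1 - (- 1) ^ k * \<phi> 1 \<le> 2 * (1 + norm \<kappa>) ^ k" by linarith
  then show "sm_integral (frag_coeff \<gamma> \<kappa> k) \<phi> \<le> 2 * (1 + norm \<kappa>) ^ k / fact k"
    unfolding sm_integral_frag_coeff[OF \<phi> \<kappa>] by (intro divide_right_mono) auto
qed


section \<open>The fundamental solution\<close>

text \<open>
  The test function \<open>\<phi> x = max 0 (x - 1)\<close> is convex with \<open>\<phi> 0 = 0\<close>, so \<open>\<phi> (x z) \<le> z \<phi> x\<close> for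
  \<open>z \<in> [0, 1]\<close>. As \<open>\<kappa>\<close> has first moment \<open>1\<close>, the dual operator sends \<open>\<phi>\<close> to a nonpositive function and
  \<open>\<langle>\<mu>\<^sub>t, \<phi>\<rangle> \<le> \<phi> 1 = 0\<close>. For a nonnegative measure this forces \<open>\<phi> = 0\<close> almost everywhere.
\<close>

lemma fundamental_solution_null:
  assumes \<kappa>: "frag_kernel \<kappa>" and \<mu>: "fundamental_solution \<alpha> \<gamma> \<kappa> \<mu>" and "\<alpha> > 0" "t \<ge> 0"
  shows "sm_null_on {1<..} (\<mu> t)"
proof -
  define \<phi> :: "real \<Rightarrow> real" where "\<phi> x = max 0 (x - 1)" for x
  have cont: "continuous_on {0..} \<phi>" unfolding \<phi>_def by (intro continuous_intros)
  have "bounded ((\<lambda>x. \<phi> x / (1 + x)) ` {0..})"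
    by (rule boundedI[where B = 1]) (auto simp: \<phi>_def max_def)
  then have int: "sm_integrable (\<mu> t) \<phi>"
    and eq: "sm_integral (\<mu> t) \<phi> = sm_integral (dirac 1) \<phi> +
      (LINT s:{0..t}|lborel. sm_integral (\<mu> s) (frag_dual \<alpha> \<gamma> \<kappa> \<phi>))"
    using \<mu> cont \<open>t \<ge> 0\<close> by (auto simp: fundamental_solution_def measure_solution_def)
  have nonneg: "sm_nonneg (\<mu> s)" if "s \<ge> 0" for s
    using \<mu> that by (simp add: fundamental_solution_def)
  have \<kappa>nn: "sm_nonneg \<kappa>" and \<kappa>1: "sm_integral \<kappa> (\<lambda>z. indicator {0..1} z * z) = 1"
    using \<kappa> by (auto simp: frag_kernel_def)
  have ind: "(indicator {0..1} :: real \<Rightarrow> real) \<in> borel_measurable borel_Rp"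
    and id: "(\<lambda>z::real. z) \<in> borel_measurable borel_Rp"
    by (auto intro: measurable_restrict_space1)
  have \<phi>m: "(\<lambda>z. \<phi> (x * z)) \<in> borel_measurable borel_Rp" for x
    unfolding \<phi>_def using id by measurable
  have dual: "frag_dual \<alpha> \<gamma> \<kappa> \<phi> x \<le> 0" if x: "x \<ge> 0" for x
  proof -
    have conv: "\<phi> (x * z) \<le> \<phi> x * z" if z: "0 \<le> z" "z \<le> 1" for z
    proof -
      have "x * z - 1 \<le> (x - 1) * z" using z by (simp add: algebra_simps)
      also have "\<dots> \<le> \<phi> x * z" using z by (intro mult_right_mono) (auto simp: \<phi>_def)
      finally show ?thesis using z by (simp add: \<phi>_def)
    qed
    have \<phi>0: "\<phi> y \<ge> 0" for y by (simp add: \<phi>_def)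
    have "sm_integral \<kappa> (\<lambda>z. indicator {0..1} z * \<phi> (x * z))
        \<le> sm_integral \<kappa> (\<lambda>z. \<phi> x * (indicator {0..1} z * z))"
    proof (rule sm_integral_mono[OF \<kappa>nn])
      show "sm_integrable \<kappa> (\<lambda>z. indicator {0..1} z * \<phi> (x * z))"
        by (rule sm_integrable_bounded[OF borel_measurable_times[OF ind \<phi>m], of _ "\<phi> x"])
          (use \<phi>0 in \<open>auto simp: indicator_def intro!: order_trans[OF conv] mult_left_le\<close>)
      show "sm_integrable \<kappa> (\<lambda>z. \<phi> x * (indicator {0..1} z * z))"
        by (rule sm_integrable_bounded[OF borel_measurable_times[OF borel_measurable_const
              borel_measurable_times[OF ind id]], of _ "\<phi> x"])
          (use \<phi>0 in \<open>auto simp: indicator_def intro!: mult_left_le\<close>)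
    qed (use conv in \<open>auto simp: indicator_def\<close>)
    then have "sm_integral \<kappa> (\<lambda>z. indicator {0..1} z * \<phi> (x * z)) \<le> \<phi> x"
      by (simp add: sm_integral_cmult \<kappa>1)
    then show ?thesis
      using \<open>\<alpha> > 0\<close> by (auto simp: frag_dual_def intro!: mult_nonneg_nonpos)
  qed
  have dual_int: "sm_integral (\<mu> s) (frag_dual \<alpha> \<gamma> \<kappa> \<phi>) \<le> 0" if "s \<ge> 0" for s
    using sm_integral_nonneg[OF nonneg[OF that], of "\<lambda>x. - 1 * frag_dual \<alpha> \<gamma> \<kappa> \<phi> x"] dual
    unfolding sm_integral_cmult by simp
  have "0 \<le> (LINT s:{0..t}|lborel. - sm_integral (\<mu> s) (frag_dual \<alpha> \<gamma> \<kappa> \<phi>))"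
    unfolding set_lebesgue_integral_def
    by (rule integral_nonneg_AE, rule AE_I2) (use dual_int in \<open>auto simp: indicator_def\<close>)
  then have "(LINT s:{0..t}|lborel. sm_integral (\<mu> s) (frag_dual \<alpha> \<gamma> \<kappa> \<phi>)) \<le> 0"
    by (simp add: set_lebesgue_integral_def)
  moreover have "sm_integral (dirac 1) \<phi> = 0"
    using sm_integral_dirac[of \<phi> 1] \<phi>m[of 1] by (simp add: \<phi>_def[abs_def])
  ultimately have "sm_integral (\<mu> t) \<phi> \<le> 0" using eq by simp
  moreover have "sm_integral (\<mu> t) \<phi> \<ge> 0"
    using \<open>t \<ge> 0\<close> by (intro sm_integral_nonneg nonneg) (auto simp: \<phi>_def)
  ultimately have "integral\<^sup>L (pos_part (\<mu> t)) \<phi> = 0"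
    using sm_integral_nonneg_measure[OF nonneg[OF \<open>t \<ge> 0\<close>]] by simp
  then have "AE x in pos_part (\<mu> t). \<phi> x = 0"
    using int by (subst (asm) integral_nonneg_eq_0_iff_AE) (auto simp: sm_integrable_def \<phi>_def)
  then have pos: "AE x in pos_part (\<mu> t). x \<notin> {1<..}"
    by eventually_elim (auto simp: \<phi>_def)
  have "AE x in neg_part (\<mu> t). x \<notin> {1<..}"
    using sm_nonneg_AE_neg_part[OF nonneg[OF \<open>t \<ge> 0\<close>]] by eventually_elim simp
  with pos show ?thesis by (simp add: sm_null_on_iff_AE)
qed

text \<open>
  The equation in terms of the truncated generator. Narrow continuity makes the integrand continuous
  in time, which turns the Lebesgue integral into a gauge integral.
\<close>

lemma fundamental_solution_integral_equation:
  assumes \<kappa>: "frag_kernel \<kappa>" and \<mu>: "fundamental_solution \<alpha> \<gamma> \<kappa> \<mu>" and "\<alpha> > 0" "\<gamma> > 0" "t \<ge> 0"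
    and \<phi>: "test_fun K \<phi>"
  shows "((\<lambda>s. \<alpha> * sm_integral (\<mu> s) (frag_gen \<gamma> \<kappa> \<phi>)) has_integral
     (sm_integral (\<mu> t) \<phi> - \<phi> 1)) {0..t}"
proof -
  let ?g = "\<lambda>s. \<alpha> * sm_integral (\<mu> s) (frag_gen \<gamma> \<kappa> \<phi>)"
  have cont: "continuous_on {0..} \<phi>" using \<phi> by (simp add: test_fun_def)
  have "bounded ((\<lambda>x. \<phi> x / (1 + x)) ` {0..})"
  proof (rule boundedI[where B = K])
    fix v assume "v \<in> (\<lambda>x. \<phi> x / (1 + x)) ` {0..}"
    then obtain x where v: "v = \<phi> x / (1 + x)" and x: "x \<ge> 0" by auto
    have "\<bar>\<phi> x\<bar> \<le> K" using \<phi> x by (simp add: test_fun_def)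
    also have "\<dots> \<le> K * (1 + x)" using test_fun_nonneg[OF \<phi>] x by (simp add: distrib_left)
    finally show "norm v \<le> K" using x by (simp add: v divide_le_eq abs_divide)
  qed
  then have sol: "sm_integrable (\<mu> s) (frag_dual \<alpha> \<gamma> \<kappa> \<phi>)"
      "sm_integral (\<mu> s) \<phi> = sm_integral (dirac 1) \<phi> +
        (LINT r:{0..s}|lborel. sm_integral (\<mu> r) (frag_dual \<alpha> \<gamma> \<kappa> \<phi>))" if "s \<ge> 0" for s
    using \<mu> cont that by (auto simp: fundamental_solution_def measure_solution_def)
  have dual: "sm_integral (\<mu> s) (frag_dual \<alpha> \<gamma> \<kappa> \<phi>) = ?g s" if s: "s \<ge> 0" for s
  proof -
    have "frag_dual \<alpha> \<gamma> \<kappa> \<phi> x = \<alpha> * frag_gen \<gamma> \<kappa> \<phi> x" if x: "x \<ge> 0" "x \<notin> {1<..}" for x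
    proof -
      have m: "(\<lambda>z. \<phi> (z * x)) \<in> borel_measurable borel_Rp"
        using test_fun_measurable[OF test_fun_slice[OF \<phi> x(1)]] .
      have "sm_integral \<kappa> (\<lambda>z. indicator {0..1} z * \<phi> (x * z)) = sm_integral \<kappa> (\<lambda>z. \<phi> (z * x))"
      proof (rule sm_integral_cong_null[OF frag_kernel_null[OF \<kappa>]])
        have "(indicator {0..1} :: real \<Rightarrow> real) \<in> borel_measurable borel_Rp"
          by (intro measurable_restrict_space1) simp
        from borel_measurable_times[OF this m]
        show "(\<lambda>z. indicator {0..1} z * \<phi> (x * z)) \<in> borel_measurable borel_Rp"
          by (simp add: mult.commute[of x])
      qed (use m in \<open>auto simp: indicator_def mult.commute\<close>)
      then show ?thesis using x by (simp add: frag_dual_def frag_gen_def algebra_simps)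
    qed
    then have "sm_integral (\<mu> s) (frag_dual \<alpha> \<gamma> \<kappa> \<phi>) = sm_integral (\<mu> s) (\<lambda>x. \<alpha> * frag_gen \<gamma> \<kappa> \<phi> x)"
      using sm_integrable_imp_measurable[OF sol(1)[OF s]]
        test_fun_measurable[OF test_fun_frag_gen[OF \<phi> \<open>\<gamma> > 0\<close>]]
      by (intro sm_integral_cong_null[OF fundamental_solution_null[OF \<kappa> \<mu> \<open>\<alpha> > 0\<close> s]]) auto
    then show ?thesis by (simp add: sm_integral_cmult)
  qed
  have G: "test_fun ((1 + norm \<kappa>) * K) (frag_gen \<gamma> \<kappa> \<phi>)" by (rule test_fun_frag_gen) fact+
  then have "bounded (frag_gen \<gamma> \<kappa> \<phi> ` {0..})"
    by (intro boundedI[where B = "(1 + norm \<kappa>) * K"]) (auto simp: test_fun_def)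
  then have "continuous_on {0..} (\<lambda>s. sm_integral (\<mu> s) (frag_gen \<gamma> \<kappa> \<phi>))"
    using \<mu> G by (auto simp: fundamental_solution_def measure_solution_def test_fun_def)
  then have "continuous_on {0..t} ?g"
    by (intro continuous_intros) (auto elim: continuous_on_subset)
  then have si: "set_integrable lborel {0..t} ?g" by (rule borel_integrable_atLeastAtMost')
  have "(LINT r:{0..t}|lborel. sm_integral (\<mu> r) (frag_dual \<alpha> \<gamma> \<kappa> \<phi>)) = (LINT r:{0..t}|lborel. ?g r)"
    using dual by (intro set_lebesgue_integral_cong) auto
  also have "\<dots> = integral {0..t} ?g" by (rule set_borel_integral_eq_integral(2)[OF si])
  finally have "sm_integral (\<mu> t) \<phi> - \<phi> 1 = integral {0..t} ?g"
    using sol(2)[OF \<open>t \<ge> 0\<close>] sm_integral_dirac[OF test_fun_measurable[OF \<phi>], of 1] by simp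
  then show ?thesis
    using set_borel_integral_eq_integral(1)[OF si] by (simp add: has_integral_integral)
qed

lemma has_integral_power_over_fact:
  fixes b t :: real
  assumes "t \<ge> 0"
  shows "((\<lambda>s. b * ((b * s) ^ k / fact k)) has_integral (b * t) ^ Suc k / fact (Suc k)) {0..t}"
proof -
  have "((\<lambda>s. (b * s) ^ Suc k / fact (Suc k)) has_vector_derivative b * ((b * s) ^ k / fact k)) (at s within {0..t})" for s
    unfolding has_real_derivative_iff_has_vector_derivative[symmetric]
    by (rule derivative_eq_intros refl | simp)+
  then show ?thesis
    using fundamental_theorem_of_calculus[OF assms, of "\<lambda>s. (b * s) ^ Suc k / fact (Suc k)" "\<lambda>s. b * ((b * s) ^ k / fact k)"]
    by simp
qed

text \<open>
  The remainder of order \<open>n + 1\<close> for \<open>\<phi>\<close> is \<open>\<alpha>\<close> times the time integral of the remainder of order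
  \<open>n\<close> for \<open>G \<phi>\<close>, whose bound carries the extra factor \<open>1 + \<parallel>\<kappa>\<parallel>\<close>.
\<close>

lemma fundamental_solution_remainder:
  assumes \<kappa>: "frag_kernel \<kappa>" and \<mu>: "fundamental_solution \<alpha> \<gamma> \<kappa> \<mu>" and "\<alpha> > 0" "\<gamma> > 0"
    and M: "\<And>s. 0 \<le> s \<Longrightarrow> s \<le> T \<Longrightarrow> norm (\<mu> s) \<le> M"
    and "test_fun K \<phi>" "0 \<le> t" "t \<le> T"
  shows "\<bar>sm_integral (\<mu> t) \<phi> - (\<Sum>k<n. (\<alpha> * t) ^ k / fact k * (frag_gen \<gamma> \<kappa> ^^ k) \<phi> 1)\<bar>
     \<le> M * K * ((\<alpha> * (1 + norm \<kappa>) * t) ^ n / fact n)"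
  using assms(6-8)
proof (induction n arbitrary: K \<phi> t)
  case 0
  have "\<bar>sm_integral (\<mu> t) \<phi>\<bar> \<le> norm (\<mu> t) * K" by (rule abs_sm_integral_le_norm) fact
  also have "\<dots> \<le> M * K" using 0 M test_fun_nonneg by (intro mult_right_mono) auto
  finally show ?case by simp
next
  case (Suc n)
  let ?G = "frag_gen \<gamma> \<kappa>" and ?b = "\<alpha> * (1 + norm \<kappa>)"
  let ?r = "\<lambda>s. sm_integral (\<mu> s) (?G \<phi>) - (\<Sum>k<n. (\<alpha> * s) ^ k / fact k * (?G ^^ k) (?G \<phi>) 1)"
  have "((\<lambda>s. \<alpha> * sm_integral (\<mu> s) (?G \<phi>) - (\<Sum>k<n. \<alpha> * ((\<alpha> * s) ^ k / fact k) * (?G ^^ k) (?G \<phi>) 1))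
      has_integral (sm_integral (\<mu> t) \<phi> - \<phi> 1) -
        (\<Sum>k<n. (\<alpha> * t) ^ Suc k / fact (Suc k) * (?G ^^ k) (?G \<phi>) 1)) {0..t}"
    using Suc.prems
    by (intro has_integral_diff has_integral_sum has_integral_mult_left has_integral_power_over_fact
        fundamental_solution_integral_equation[OF \<kappa> \<mu> \<open>\<alpha> > 0\<close> \<open>\<gamma> > 0\<close>]) auto
  moreover have "(\<lambda>s. \<alpha> * sm_integral (\<mu> s) (?G \<phi>) - (\<Sum>k<n. \<alpha> * ((\<alpha> * s) ^ k / fact k) * (?G ^^ k) (?G \<phi>) 1))
      = (\<lambda>s. \<alpha> * ?r s)"
    by (simp add: right_diff_distrib sum_distrib_left mult.assoc)
  moreover have "(\<Sum>k<Suc n. (\<alpha> * t) ^ k / fact k * (?G ^^ k) \<phi> 1) =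
      \<phi> 1 + (\<Sum>k<n. (\<alpha> * t) ^ Suc k / fact (Suc k) * (?G ^^ k) (?G \<phi>) 1)"
    by (subst sum.lessThan_Suc_shift) (simp add: funpow_swap1)
  ultimately have r: "((\<lambda>s. \<alpha> * ?r s) has_integral
      (sm_integral (\<mu> t) \<phi> - (\<Sum>k<Suc n. (\<alpha> * t) ^ k / fact k * (?G ^^ k) \<phi> 1))) {0..t}"
    by (simp add: algebra_simps)
  have b: "((\<lambda>s. M * K * (?b * ((?b * s) ^ n / fact n))) has_integral
      M * K * ((?b * t) ^ Suc n / fact (Suc n))) {0..t}"
    using Suc.prems by (intro has_integral_mult_right has_integral_power_over_fact)
  have "norm (\<alpha> * ?r s) \<le> M * K * (?b * ((?b * s) ^ n / fact n))" if s: "s \<in> {0..t}" for s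
  proof -
    have "\<alpha> * \<bar>?r s\<bar> \<le> \<alpha> * (M * ((1 + norm \<kappa>) * K) * ((?b * s) ^ n / fact n))"
      using s Suc.prems \<open>\<alpha> > 0\<close> \<open>\<gamma> > 0\<close>
      by (intro mult_left_mono Suc.IH test_fun_frag_gen) auto
    then show ?thesis using \<open>\<alpha> > 0\<close> by (simp add: abs_mult mult_ac)
  qed
  then have "norm (sm_integral (\<mu> t) \<phi> - (\<Sum>k<Suc n. (\<alpha> * t) ^ k / fact k * (?G ^^ k) \<phi> 1))
      \<le> M * K * ((?b * t) ^ Suc n / fact (Suc n))"
    using r b by (metis (no_types, lifting) has_integral_integrable_integral integral_norm_bound_integral)
  then show ?case by simp
qed

lemma fundamental_solution_sums:
  assumes \<kappa>: "frag_kernel \<kappa>" and \<mu>: "fundamental_solution \<alpha> \<gamma> \<kappa> \<mu>" and "\<alpha> > 0" "\<gamma> > 0"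
    and \<phi>: "test_fun K \<phi>" and t: "t \<ge> 0"
  shows "(\<lambda>k. (\<alpha> * t) ^ k / fact k * (frag_gen \<gamma> \<kappa> ^^ k) \<phi> 1) sums sm_integral (\<mu> t) \<phi>"
proof -
  have "continuous_on {0..t} \<mu>"
    using \<mu> by (auto simp: fundamental_solution_def elim: continuous_on_subset)
  then have "bounded (\<mu> ` {0..t})"
    by (intro compact_imp_bounded compact_continuous_image compact_Icc)
  then obtain M where "\<forall>\<nu>\<in>\<mu> ` {0..t}. norm \<nu> \<le> M"
    unfolding bounded_iff by blast
  then have M: "norm (\<mu> s) \<le> M" if "0 \<le> s" "s \<le> t" for s using that by simp
  let ?x = "\<alpha> * (1 + norm \<kappa>) * t"
  have "(\<lambda>n. ?x ^ n / fact n) \<longlonglongrightarrow> 0"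
    using summable_LIMSEQ_zero[OF summable_exp[of ?x]] by (simp add: divide_inverse mult.commute)
  then have lim: "(\<lambda>n. M * K * (?x ^ n / fact n)) \<longlonglongrightarrow> 0"
    by (rule tendsto_mult_right_zero)
  have "(\<lambda>n. (\<Sum>k<n. (\<alpha> * t) ^ k / fact k * (frag_gen \<gamma> \<kappa> ^^ k) \<phi> 1) - sm_integral (\<mu> t) \<phi>) \<longlonglongrightarrow> 0"
    by (rule Lim_null_comparison[OF _ lim])
      (use fundamental_solution_remainder[OF assms(1-4) M \<phi> t order.refl]
        in \<open>auto simp: abs_minus_commute\<close>)
  then show ?thesis unfolding sums_def by (simp add: LIM_zero_iff)
qed

text \<open>Subtracting the exponential series termwise replaces \<open>G\<^sup>k\<close> by the coefficients \<open>a\<^sub>k\<close>.\<close>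

lemma fundamental_solution_series:
  assumes \<kappa>: "frag_kernel \<kappa>" and \<mu>: "fundamental_solution \<alpha> \<gamma> \<kappa> \<mu>" and "\<alpha> > 0" "\<gamma> > 0"
    and \<phi>: "test_fun K \<phi>" and t: "t \<ge> 0"
  shows "(\<lambda>k. (\<alpha> * t) ^ k * sm_integral (frag_coeff \<gamma> \<kappa> k) \<phi>) sums
     (sm_integral (\<mu> t) \<phi> - exp (- \<alpha> * t) * \<phi> 1)"
proof -
  have "(\<lambda>k. (- \<alpha> * t) ^ k / fact k * \<phi> 1) sums (exp (- \<alpha> * t) * \<phi> 1)"
    using sums_mult2[OF exp_converges[of "- \<alpha> * t"], of "\<phi> 1"] by (simp add: divide_inverse mult_ac)
  from sums_diff[OF fundamental_solution_sums[OF assms] this] show ?thesis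
    unfolding sm_integral_frag_coeff[OF \<phi> frag_kernel_null[OF \<kappa>] \<open>\<gamma> > 0\<close>]
    by (simp add: power_mult_distrib power_minus[of "\<alpha> * t"] field_simps)
qed

section \<open>The error of the estimator\<close>

lemma summable_norm_frag_coeff:
  assumes \<kappa>: "frag_kernel \<kappa>" and "\<gamma> > 0" "x \<ge> 0"
  shows "summable (\<lambda>n. x ^ n * norm (frag_coeff \<gamma> \<kappa> (n + 2)))"
proof (rule summable_comparison_test')
  let ?q = "1 + norm \<kappa>"
  show "summable (\<lambda>n. 2 * ?q ^ 2 * (inverse (fact n) * (x * ?q) ^ n))"
    by (intro summable_mult summable_exp)
  fix n :: nat
  have "norm (frag_coeff \<gamma> \<kappa> (n + 2)) \<le> 2 * ?q ^ (n + 2) / fact (n + 2)"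
    by (rule norm_frag_coeff_le[OF frag_kernel_null[OF \<kappa>] \<open>\<gamma> > 0\<close>])
  also have "\<dots> \<le> 2 * ?q ^ (n + 2) / fact n"
    by (intro divide_left_mono fact_mono mult_pos_pos) auto
  finally have "x ^ n * norm (frag_coeff \<gamma> \<kappa> (n + 2)) \<le> x ^ n * (2 * ?q ^ (n + 2) / fact n)"
    using \<open>x \<ge> 0\<close> by (intro mult_left_mono) auto
  then show "norm (x ^ n * norm (frag_coeff \<gamma> \<kappa> (n + 2))) \<le> 2 * ?q ^ 2 * (inverse (fact n) * (x * ?q) ^ n)"
    using \<open>x \<ge> 0\<close>
    by (simp add: power_mult_distrib power_add power2_eq_square divide_inverse mult_ac
        del: frag_coeff.simps)
qed

lemma norm_kappa_est_diff_le:
  assumes \<kappa>: "frag_kernel \<kappa>" and \<mu>: "fundamental_solution \<alpha> \<gamma> \<kappa> \<mu>" and "\<alpha> > 0" "\<gamma> > 0" "t > 0"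
  shows "norm (kappa_est \<alpha> \<mu> t - \<kappa>) \<le> \<alpha> * t * (\<Sum>n. (\<alpha> * t) ^ n * norm (frag_coeff \<gamma> \<kappa> (n + 2)))"
proof (rule norm_smeasure_le)
  fix \<phi> assume \<phi>: "test_fun 1 \<phi>"
  let ?I = "\<lambda>k. sm_integral (frag_coeff \<gamma> \<kappa> k) \<phi>" and ?x = "\<alpha> * t"
  have x: "?x > 0" using assms by simp
  have "sm_integral (dirac 1) \<phi> = \<phi> 1"
    using sm_integral_dirac[OF test_fun_measurable[OF \<phi>], of 1] by simp
  then have est: "sm_integral (kappa_est \<alpha> \<mu> t - \<kappa>) \<phi> =
      (sm_integral (\<mu> t) \<phi> - exp (- \<alpha> * t) * \<phi> 1) / ?x - sm_integral \<kappa> \<phi>"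
    by (simp add: kappa_est_def sm_integral_scaleR_measure sm_integral_minus_measure
        test_fun_sm_integrable[OF \<phi>])
  have a0: "?I 0 = 0" and a1: "?I 1 = sm_integral \<kappa> \<phi>"
    using sm_integral_frag_coeff[OF \<phi> frag_kernel_null[OF \<kappa>] \<open>\<gamma> > 0\<close>, of 1]
    by (simp_all add: sm_integral_zero_measure frag_gen_def)
  have "(\<lambda>k. ?x ^ k * ?I k) sums (sm_integral (\<mu> t) \<phi> - exp (- \<alpha> * t) * \<phi> 1)"
    using assms by (intro fundamental_solution_series[OF _ _ _ _ \<phi>]) auto
  \<comment> \<open>The first two terms are \<open>0\<close> and \<open>\<alpha> t \<langle>\<kappa>, \<phi>\<rangle>\<close>; the latter is the leading part of the estimator.\<close>
  from sums_split_initial_segment[OF this, of 2]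
  have "(\<lambda>n. ?x ^ (n + 2) * ?I (n + 2)) sums (sm_integral (\<mu> t) \<phi> - exp (- \<alpha> * t) * \<phi> 1 - ?x * sm_integral \<kappa> \<phi>)"
    using a0 a1 by (simp add: numeral_2_eq_2 lessThan_Suc)
  from sums_divide[OF this, of ?x]
  have s: "(\<lambda>n. ?x ^ (n + 2) * ?I (n + 2) / ?x) sums sm_integral (kappa_est \<alpha> \<mu> t - \<kappa>) \<phi>"
    unfolding est using assms by (simp add: diff_divide_distrib del: frag_coeff.simps)
  have "(\<lambda>n. ?x * (?x ^ n * norm (frag_coeff \<gamma> \<kappa> (n + 2)))) sums
      (?x * (\<Sum>n. ?x ^ n * norm (frag_coeff \<gamma> \<kappa> (n + 2))))"
    using x by (intro sums_mult summable_sums summable_norm_frag_coeff \<kappa> \<open>\<gamma> > 0\<close>) auto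
  moreover have "?x ^ (n + 2) * ?I (n + 2) / ?x \<le> ?x * (?x ^ n * norm (frag_coeff \<gamma> \<kappa> (n + 2)))" for n
  proof -
    have "?x ^ (n + 2) * ?I (n + 2) / ?x = ?x * (?x ^ n * ?I (n + 2))"
      using x by (simp add: power2_eq_square power_add)
    also have "\<dots> \<le> ?x * (?x ^ n * norm (frag_coeff \<gamma> \<kappa> (n + 2)))"
      using x by (intro mult_left_mono sm_integral_le_norm \<phi>) auto
    finally show ?thesis .
  qed
  ultimately show "sm_integral (kappa_est \<alpha> \<mu> t - \<kappa>) \<phi> \<le> ?x * (\<Sum>n. ?x ^ n * norm (frag_coeff \<gamma> \<kappa> (n + 2)))"
    using s by (intro sums_le[OF _ s]) auto
qed

theorem theorem5:
  fixes \<alpha> \<gamma> T :: real and \<kappa> :: smeasure and \<mu>F :: "real \<Rightarrow> smeasure"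
  assumes "\<alpha> > 0" and "\<gamma> > 0" and "frag_kernel \<kappa>"
    and "fundamental_solution \<alpha> \<gamma> \<kappa> \<mu>F"
    and "T > 0"
  shows "let a = frag_coeff \<gamma> \<kappa>;
             S = (\<lambda>t. \<Sum>n. (\<alpha> * t) ^ n * norm (a (n + 2)));
             C = \<alpha> * (SUP t\<in>{0..T}. S t)
         in (\<forall>t\<in>{0..T}. summable (\<lambda>n. (\<alpha> * t) ^ n * norm (a (n + 2)))) \<and>
            (\<exists>t0\<in>{0..T}. \<forall>t\<in>{0..T}. S t \<le> S t0) \<and>
            C = \<alpha> * S T \<and>
            (\<forall>t\<in>{0<..T}. norm (kappa_est \<alpha> \<mu>F t - \<kappa>) \<le> C * t)"
proof -
  define S where "S t = (\<Sum>n. (\<alpha> * t) ^ n * norm (frag_coeff \<gamma> \<kappa> (n + 2)))" for t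
  have sum: "summable (\<lambda>n. (\<alpha> * t) ^ n * norm (frag_coeff \<gamma> \<kappa> (n + 2)))" if "t \<in> {0..T}" for t
    using that assms by (intro summable_norm_frag_coeff) auto
  have mono: "S t \<le> S T" if t: "t \<in> {0..T}" for t
    unfolding S_def using sum[OF t] sum[of T] t assms
    by (intro suminf_le mult_right_mono power_mono mult_left_mono) auto
  have SUP: "(SUP t\<in>{0..T}. S t) = S T"
    using mono \<open>T > 0\<close> by (intro cSup_eq_maximum) auto
  have est: "norm (kappa_est \<alpha> \<mu>F t - \<kappa>) \<le> \<alpha> * S T * t" if t: "t \<in> {0<..T}" for t
  proof -
    have "norm (kappa_est \<alpha> \<mu>F t - \<kappa>) \<le> \<alpha> * t * S t"
      unfolding S_def using assms t by (intro norm_kappa_est_diff_le) auto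
    also have "\<dots> \<le> \<alpha> * t * S T" using mono[of t] t assms by (intro mult_left_mono) auto
    finally show ?thesis by (simp add: mult_ac)
  qed
  have "\<exists>t0\<in>{0..T}. \<forall>t\<in>{0..T}. S t \<le> S t0" using mono \<open>T > 0\<close> by (intro bexI[of _ T]) auto
  then show ?thesis
    unfolding Let_def S_def[symmetric] SUP by (intro conjI ballI refl sum est)
qed

end
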